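(* Assume $\sum_{k=0}^Na_k^2>0$, let $0<\varepsilon<\min_{1\le s\le N}(r_s-r_{s-1})$, $T=1+\varepsilon$, and $(y,x_0)\in\widehat{M}^2$. Set $d^2=1+\sum_{k=1}^Nd_k^2$ and $\hat a=\big(d^{-2}\sum_{k=0}^Na_k^2\big)^{1/2}>0$. Then the problem $\|u\|_{L^2(0,T)}\to\min$, $u\in\mathcal{U}_T(y,x_0)$, has a unique solution $\widehat u$. It is the function $$\widehat u(t)=\begin{cases}\widehat u_0(t), & t\in[0,\varepsilon),\\ \sum_{k=s}^N\big[d_k\dot x_0(t-r_k)-a_kx_0(t-r_k)\big], & t\in[r_{s-1}+\varepsilon,r_s),\ s=1,\dots,N,\\ \varphi_s(t-r_s)+d_s\widehat u_0(t-r_s)+(d_sa_0-a_s)\int_0^{t-r_s}e^{a_0(t-r_s-\tau)}\widehat u_0(\tau)\,d\tau, & t\in[r_s,r_s+\varepsilon),\ s=1,\dots,N,\end{cases}$$ with $$\widehat u_0(t)=d^{-2}\Big[\sum_{s=1}^N\int_0^t\Big((d_sa_0-a_s)\cosh(\hat a(t-\tau))+\Big(\frac{a_sa_0}{\hat a}-d_s\hat a\Big)\sinh(\hat a(t-\tau))\Big)\varphi_s(\tau)\,d\tau-\sum_{s=1}^Nd_s\varphi_s(t)+c\Big(\cosh(\hat at)-\frac{a_0}{\hat a}\sinh(\hat at)\Big)\Big],$$ $$c=\frac{1}{\sinh(\hat a\varepsilon)}\Big(-d^2\hat a\,\widetilde{x}(\varepsilon)+\int_0^\varepsilon\sum_{s=1}^N\big(\hat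 ad_s\cosh(\hat a(\varepsilon-\tau))+a_s\sinh(\hat a(\varepsilon-\tau))\big)\varphi_s(\tau)\,d\tau\Big).$$
   Context: Fix $N\ge1$, delays $0=r_0<r_1<\dots<r_N=1$, and real coefficients $d_1,\dots,d_N$, $a_0,\dots,a_N$ with $d_N^2+a_N^2\ne0$. Consider the scalar control equation $\dot x(t)+\sum_{k=1}^Nd_k\dot x(t-r_k)=\sum_{k=0}^Na_kx(t-r_k)+u(t)$, $t\ge0$, with control $u\in L^2_{loc}(0,\infty)$ and initial data $x(0)=y$, $x(t)=x_0(t)$ for $t\in[-1,0)$, where $(y,x_0)\in\widehat{M}^2=\{(y,x_0):x_0\in W^{1,2}(-1,0),\ y=x_0(0)\}$. For every such state and control there is a unique continuous solution $x(t;y,x_0,u)$. For $T>1$, $\mathcal{U}_T(y,x_0)$ is the set of $u\in L^2(0,T)$ with $x(t;y,x_0,u)=0$ for all $t\in[T-1,T]$. For $\sigma\in[0,\varepsilon]$ define $\widetilde{x}(\sigma)=e^{a_0\sigma}\big(y+\int_0^\sigma e^{-a_0\tau}\sum_{k=1}^N[a_kx_0(\tau-r_k)-d_k\dot x_0(\tau-r_k)]d\tau\big)$ and, for $s=1,\dots,N$, $\varphi_s(\sigma)=(d_sa_0-a_s)\widetilde{x}(\sigma)+\sum_{k=s+1}^N[d_k\dot x_0(\sigma+r_s-r_k)-a_kx_0(\sigma+r_s-r_k)]-d_s\sum_{k=1}^N[d_k\dot x_0(\sigma-r_k)-a_kx_0(\sigma-r_k)]$. *)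

theory Defs
  imports "HOL-Analysis.Analysis"
begin

text \<open>Data: delays r 0 = 0 < r 1 < ... < r N = 1, coefficients d 1..d N, a 0..a N.
  The initial state (y, x0) with x0 in W^{1,2}(-1,0), y = x0 0; x0' is a derivative
  representative of x0 (x0 is the integral of x0', x0' square integrable).\<close>

definition W12_state :: "real \<Rightarrow> (real \<Rightarrow> real) \<Rightarrow> (real \<Rightarrow> real) \<Rightarrow> bool" where
  "W12_state y x0 x0' \<longleftrightarrow>
     x0' measurable_on {-1..0} \<and> (\<lambda>s. (x0' s)\<^sup>2) integrable_on {-1..0} \<and>
     (\<forall>t\<in>{-1..0}. (x0' has_integral (x0 t - x0 (-1))) {-1..t}) \<and>
     y = x0 0"

definition L2_on :: "real set \<Rightarrow> (real \<Rightarrow> real) \<Rightarrow> bool" where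
  "L2_on S u \<longleftrightarrow> u measurable_on S \<and> (\<lambda>t. (u t)\<^sup>2) integrable_on S"

definition L2_norm_on :: "real set \<Rightarrow> (real \<Rightarrow> real) \<Rightarrow> real" where
  "L2_norm_on S u = sqrt (integral S (\<lambda>t. (u t)\<^sup>2))"

text \<open>Solution of the neutral equation on [-1,T] (integrated form):
  x continuous, x = x0 on [-1,0], and for t in [0,T]
  x(t) + sum d_k x(t-r_k) = x(0) + sum d_k x(-r_k) + int_0^t (sum a_k x(tau-r_k) + u(tau)).\<close>
definition is_solution ::
  "nat \<Rightarrow> (nat \<Rightarrow> real) \<Rightarrow> (nat \<Rightarrow> real) \<Rightarrow> (nat \<Rightarrow> real) \<Rightarrow> real \<Rightarrow>
   (real \<Rightarrow> real) \<Rightarrow> (real \<Rightarrow> real) \<Rightarrow> real \<Rightarrow> (real \<Rightarrow> real) \<Rightarrow> bool" where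
  "is_solution N r d a y x0 u T x \<longleftrightarrow>
     continuous_on {-1..T} x \<and> x 0 = y \<and> (\<forall>t\<in>{-1..<0}. x t = x0 t) \<and>
     (\<forall>t\<in>{0..T}.
        x t + (\<Sum>k=1..N. d k * x (t - r k)) =
        x 0 + (\<Sum>k=1..N. d k * x (- r k)) +
        integral {0..t} (\<lambda>\<tau>. (\<Sum>k=0..N. a k * x (\<tau> - r k)) + u \<tau>))"

definition admissible ::
  "nat \<Rightarrow> (nat \<Rightarrow> real) \<Rightarrow> (nat \<Rightarrow> real) \<Rightarrow> (nat \<Rightarrow> real) \<Rightarrow> real \<Rightarrow>
   (real \<Rightarrow> real) \<Rightarrow> real \<Rightarrow> (real \<Rightarrow> real) set" where
  "admissible N r d a y x0 T =
     {u. L2_on {0..T} u \<and>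
         (\<exists>x. is_solution N r d a y x0 u T x \<and> (\<forall>t\<in>{T-1..T}. x t = 0))}"

definition xtil ::
  "nat \<Rightarrow> (nat \<Rightarrow> real) \<Rightarrow> (nat \<Rightarrow> real) \<Rightarrow> (nat \<Rightarrow> real) \<Rightarrow> real \<Rightarrow>
   (real \<Rightarrow> real) \<Rightarrow> (real \<Rightarrow> real) \<Rightarrow> real \<Rightarrow> real" where
  "xtil N r d a y x0 x0' \<sigma> =
     exp (a 0 * \<sigma>) * (y + integral {0..\<sigma>} (\<lambda>\<tau>. exp (- a 0 * \<tau>) *
        (\<Sum>k=1..N. a k * x0 (\<tau> - r k) - d k * x0' (\<tau> - r k))))"

definition phi ::
  "nat \<Rightarrow> (nat \<Rightarrow> real) \<Rightarrow> (nat \<Rightarrow> real) \<Rightarrow> (nat \<Rightarrow> real) \<Rightarrow> real \<Rightarrow>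
   (real \<Rightarrow> real) \<Rightarrow> (real \<Rightarrow> real) \<Rightarrow> nat \<Rightarrow> real \<Rightarrow> real" where
  "phi N r d a y x0 x0' s \<sigma> =
     (d s * a 0 - a s) * xtil N r d a y x0 x0' \<sigma>
     + (\<Sum>k=s+1..N. d k * x0' (\<sigma> + r s - r k) - a k * x0 (\<sigma> + r s - r k))
     - d s * (\<Sum>k=1..N. d k * x0' (\<sigma> - r k) - a k * x0 (\<sigma> - r k))"

definition dsq :: "nat \<Rightarrow> (nat \<Rightarrow> real) \<Rightarrow> real" where
  "dsq N d = 1 + (\<Sum>k=1..N. (d k)\<^sup>2)"

definition ahat :: "nat \<Rightarrow> (nat \<Rightarrow> real) \<Rightarrow> (nat \<Rightarrow> real) \<Rightarrow> real" where
  "ahat N d a = sqrt ((\<Sum>k=0..N. (a k)\<^sup>2) / dsq N d)"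

definition cconst ::
  "nat \<Rightarrow> (nat \<Rightarrow> real) \<Rightarrow> (nat \<Rightarrow> real) \<Rightarrow> (nat \<Rightarrow> real) \<Rightarrow> real \<Rightarrow>
   (real \<Rightarrow> real) \<Rightarrow> (real \<Rightarrow> real) \<Rightarrow> real \<Rightarrow> real" where
  "cconst N r d a y x0 x0' \<epsilon> =
     (let ah = ahat N d a in
      (1 / sinh (ah * \<epsilon>)) *
      (- dsq N d * ah * xtil N r d a y x0 x0' \<epsilon> +
       integral {0..\<epsilon>} (\<lambda>\<tau>. \<Sum>s=1..N.
          (ah * d s * cosh (ah * (\<epsilon> - \<tau>)) + a s * sinh (ah * (\<epsilon> - \<tau>))) *
          phi N r d a y x0 x0' s \<tau>)))"

definition uhat0 ::
  "nat \<Rightarrow> (nat \<Rightarrow> real) \<Rightarrow> (nat \<Rightarrow> real) \<Rightarrow> (nat \<Rightarrow> real) \<Rightarrow> real \<Rightarrow>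
   (real \<Rightarrow> real) \<Rightarrow> (real \<Rightarrow> real) \<Rightarrow> real \<Rightarrow> real \<Rightarrow> real" where
  "uhat0 N r d a y x0 x0' \<epsilon> t =
     (let ah = ahat N d a; ph = phi N r d a y x0 x0' in
      (1 / dsq N d) *
      ((\<Sum>s=1..N. integral {0..t} (\<lambda>\<tau>.
          ((d s * a 0 - a s) * cosh (ah * (t - \<tau>)) +
           (a s * a 0 / ah - d s * ah) * sinh (ah * (t - \<tau>))) * ph s \<tau>))
       - (\<Sum>s=1..N. d s * ph s t)
       + cconst N r d a y x0 x0' \<epsilon> * (cosh (ah * t) - a 0 / ah * sinh (ah * t))))"

text \<open>The optimal control on [0,T), T = 1 + eps (value 0 elsewhere, irrelevant a.e.).\<close>
definition uhat ::
  "nat \<Rightarrow> (nat \<Rightarrow> real) \<Rightarrow> (nat \<Rightarrow> real) \<Rightarrow> (nat \<Rightarrow> real) \<Rightarrow> real \<Rightarrow>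
   (real \<Rightarrow> real) \<Rightarrow> (real \<Rightarrow> real) \<Rightarrow> real \<Rightarrow> real \<Rightarrow> real" where
  "uhat N r d a y x0 x0' \<epsilon> t =
     (let u0 = uhat0 N r d a y x0 x0' \<epsilon>; ph = phi N r d a y x0 x0' in
      if 0 \<le> t \<and> t < \<epsilon> then u0 t
      else if \<exists>s\<in>{1..N}. r (s-1) + \<epsilon> \<le> t \<and> t < r s then
        (let s = (THE s. s \<in> {1..N} \<and> r (s-1) + \<epsilon> \<le> t \<and> t < r s) in
         \<Sum>k=s..N. d k * x0' (t - r k) - a k * x0 (t - r k))
      else if \<exists>s\<in>{1..N}. r s \<le> t \<and> t < r s + \<epsilon> then
        (let s = (THE s. s \<in> {1..N} \<and> r s \<le> t \<and> t < r s + \<epsilon>) in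
         ph s (t - r s) + d s * u0 (t - r s) +
         (d s * a 0 - a s) * integral {0..t - r s} (\<lambda>\<tau>. exp (a 0 * (t - r s - \<tau>)) * u0 \<tau>))
      else 0)"

end

theory Submission
  imports Defs
begin

text \<open>Forcing \<open>x = 0\<close> on \<open>[\<epsilon>, T]\<close> determines a control from its values on \<open>[0, \<epsilon>)\<close>: with \<open>h = x\<close> on
  \<open>[0, \<epsilon>]\<close> it is an affine expression in \<open>h\<close> and \<open>h'\<close> on each \<open>[r s, r s + \<epsilon>)\<close>, and does not depend on \<open>h\<close>
  elsewhere. So the norm becomes a quadratic functional of \<open>h\<close> on \<open>[0, \<epsilon>]\<close> with fixed end points, and
  \<open>uhat\<close> comes from the explicit solution of its Euler-Lagrange equation, a linear system of two
  first order equations. Integrating that equation by parts shows that \<open>uhat\<close> is orthogonal to \<open>u - uhat\<close> for every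
  admissible \<open>u\<close>; minimality and uniqueness follow from Pythagoras. All functions are merely absolutely continuous,
  so integration by parts is needed for products of indefinite Lebesgue integrals.\<close>

section \<open>Indefinite Lebesgue integrals\<close>

text \<open>This is absolute continuity of \<open>F\<close> with almost everywhere derivative
  \<open>f\<close>, stated through integrals so that pointwise differentiability never has to be
  discussed.\<close>

definition primitive_on :: "real \<Rightarrow> real \<Rightarrow> (real \<Rightarrow> real) \<Rightarrow> (real \<Rightarrow> real) \<Rightarrow> bool" where
  "primitive_on a b F f \<longleftrightarrow>
     f absolutely_integrable_on {a..b} \<and> (\<forall>t\<in>{a..b}. (f has_integral F t - F a) {a..t})"

lemma primitive_onI:
  assumes "f absolutely_integrable_on {a..b}" "\<And>t. a \<le> t \<Longrightarrow> t \<le> b \<Longrightarrow> F t = F a + integral {a..t} f"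
  shows "primitive_on a b F f"
  unfolding primitive_on_def
proof (intro conjI ballI)
  fix t assume t: "t \<in> {a..b}"
  have "f integrable_on {a..t}"
    using set_lebesgue_integral_eq_integral(1)[OF assms(1)] t by (auto intro: integrable_on_subinterval)
  then show "(f has_integral F t - F a) {a..t}"
    using assms(2)[of t] t by (simp add: has_integral_iff)
qed (fact assms)

lemma primitive_on_absolutely_integrable: "primitive_on a b F f \<Longrightarrow> f absolutely_integrable_on {a..b}"
  by (simp add: primitive_on_def)

lemma primitive_on_has_integral:
  assumes "primitive_on a b F f" "a \<le> s" "s \<le> t" "t \<le> b"
  shows "(f has_integral F t - F s) {s..t}"
proof -
  have 1: "(f has_integral F t - F a) {a..t}" "(f has_integral F s - F a) {a..s}"
    using assms by (auto simp: primitive_on_def)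
  then have "f integrable_on {s..t}"
    using assms by (meson atLeastatMost_subset_iff has_integral_integrable integrable_on_subinterval order_refl)
  then have 2: "(f has_integral integral {s..t} f) {s..t}" by auto
  have "(f has_integral F s - F a + integral {s..t} f) {a..t}"
    using has_integral_combine[OF _ _ 1(2) 2] assms by auto
  from has_integral_unique[OF 1(1) this] have "F t - F s = integral {s..t} f" by linarith
  with 2 show ?thesis by simp
qed

lemma primitive_on_continuous:
  assumes "primitive_on a b F f" shows "continuous_on {a..b} F"
proof -
  have "f integrable_on {a..b}"
    using assms set_lebesgue_integral_eq_integral(1) by (auto simp: primitive_on_def)
  then have "continuous_on {a..b} (\<lambda>t. F a + integral {a..t} f)"
    by (intro continuous_intros indefinite_integral_continuous_1)
  moreover have "F a + integral {a..t} f = F t" if "t \<in> {a..b}" for t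
    using assms that integral_unique[of f "F t - F a" "{a..t}"] by (auto simp: primitive_on_def)
  ultimately show ?thesis by (rule continuous_on_eq)
qed

lemma primitive_on_subinterval:
  assumes "primitive_on a b F f" "a \<le> c" "d \<le> b"
  shows "primitive_on c d F f"
  unfolding primitive_on_def
proof (intro conjI ballI)
  show "f absolutely_integrable_on {c..d}"
    using assms by (intro absolutely_integrable_on_subinterval[OF primitive_on_absolutely_integrable[OF assms(1)]]) auto
  show "(f has_integral F t - F c) {c..t}" if "t \<in> {c..d}" for t
    using assms that by (intro primitive_on_has_integral[OF assms(1)]) auto
qed

lemma primitive_on_cong:
  assumes "primitive_on a b F f" "\<And>t. t \<in> {a..b} \<Longrightarrow> G t = F t"
    "negligible S" "\<And>t. t \<in> {a..b} - S \<Longrightarrow> g t = f t"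
  shows "primitive_on a b G g"
  unfolding primitive_on_def
proof (intro conjI ballI)
  show "g absolutely_integrable_on {a..b}"
    using absolutely_integrable_spike[OF primitive_on_absolutely_integrable[OF assms(1)] assms(3,4)] .
  fix t assume t: "t \<in> {a..b}"
  then have "(f has_integral G t - G a) {a..t}"
    using assms(1,2) by (auto simp: primitive_on_def)
  then show "(g has_integral G t - G a) {a..t}"
    by (rule has_integral_spike[OF assms(3), rotated]) (use assms(4) t in auto)
qed

lemma primitive_on_const: "primitive_on a b (\<lambda>t. c) (\<lambda>t. 0)"
  by (simp add: primitive_on_def)

lemma primitive_on_add:
  assumes "primitive_on a b F f" "primitive_on a b G g"
  shows "primitive_on a b (\<lambda>t. F t + G t) (\<lambda>t. f t + g t)"
  unfolding primitive_on_def
proof (intro conjI ballI)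
  show "(\<lambda>t. f t + g t) absolutely_integrable_on {a..b}"
    by (intro set_integral_add(1) primitive_on_absolutely_integrable[OF assms(1)]
        primitive_on_absolutely_integrable[OF assms(2)])
  fix t assume "t \<in> {a..b}"
  then have "((\<lambda>t. f t + g t) has_integral (F t - F a) + (G t - G a)) {a..t}"
    using assms unfolding primitive_on_def by (intro has_integral_add) blast+
  then show "((\<lambda>t. f t + g t) has_integral F t + G t - (F a + G a)) {a..t}"
    by (simp add: add_diff_add)
qed

lemma primitive_on_cmult:
  assumes "primitive_on a b F f"
  shows "primitive_on a b (\<lambda>t. c * F t) (\<lambda>t. c * f t)"
  unfolding primitive_on_def
proof (intro conjI ballI)
  show "(\<lambda>t. c * f t) absolutely_integrable_on {a..b}"
    using primitive_on_absolutely_integrable[OF assms] by simp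
  fix t assume "t \<in> {a..b}"
  then have "((\<lambda>t. c * f t) has_integral c * (F t - F a)) {a..t}"
    using assms unfolding primitive_on_def by (intro has_integral_mult_right) blast
  then show "((\<lambda>t. c * f t) has_integral c * F t - c * F a) {a..t}"
    by (simp add: right_diff_distrib)
qed

lemma primitive_on_diff:
  assumes "primitive_on a b F f" "primitive_on a b G g"
  shows "primitive_on a b (\<lambda>t. F t - G t) (\<lambda>t. f t - g t)"
  using primitive_on_add[OF assms(1) primitive_on_cmult[OF assms(2), of "-1"]] by simp

lemma primitive_on_sum:
  assumes "finite I" "\<And>i. i \<in> I \<Longrightarrow> primitive_on a b (F i) (f i)"
  shows "primitive_on a b (\<lambda>t. \<Sum>i\<in>I. F i t) (\<lambda>t. \<Sum>i\<in>I. f i t)"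
  using assms by (induction rule: finite_induct) (auto intro: primitive_on_add primitive_on_const)

lemma primitive_on_indefinite_integral:
  assumes "f absolutely_integrable_on {a..b}"
  shows "primitive_on a b (\<lambda>t. integral {a..t} f) f"
  using assms by (auto intro!: primitive_onI)

lemma primitive_on_combine:
  assumes F1: "primitive_on a b F f" and F2: "primitive_on b c F f" and le: "a \<le> b" "b \<le> c"
  shows "primitive_on a c F f"
  unfolding primitive_on_def
proof (intro conjI ballI)
  show "f absolutely_integrable_on {a..c}"
    using assms absolutely_integrable_on_combine by (auto simp: primitive_on_def)
  fix t assume t: "t \<in> {a..c}"
  show "(f has_integral F t - F a) {a..t}"
  proof (cases "t \<le> b")
    case True then show ?thesis using F1 t by (auto simp: primitive_on_def)
  next
    case False
    then have "(f has_integral (F b - F a) + (F t - F b)) {a..t}"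
      using F1 F2 t le by (intro has_integral_combine[of a b t]) (auto simp: primitive_on_def)
    then show ?thesis by simp
  qed
qed

lemma absolutely_integrable_shift:
  fixes f :: "real \<Rightarrow> real"
  assumes "f absolutely_integrable_on {a..b}"
  shows "(\<lambda>t. f (t - r)) absolutely_integrable_on {a + r..b + r}"
  using assms integrable_shift_real_ivl[of f a b "-r"] integrable_shift_real_ivl[of "\<lambda>t. norm (f t)" a b "-r"]
  by (simp add: absolutely_integrable_on_def)

lemma primitive_on_shift:
  assumes "primitive_on a b F f"
  shows "primitive_on (a + r) (b + r) (\<lambda>t. F (t - r)) (\<lambda>t. f (t - r))"
  unfolding primitive_on_def
proof (intro conjI ballI)
  show "(\<lambda>t. f (t - r)) absolutely_integrable_on {a + r..b + r}"
    using assms by (auto simp: primitive_on_def intro: absolutely_integrable_shift)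
  fix t assume "t \<in> {a + r..b + r}"
  then have "(f has_integral F (t - r) - F a) {a..t - r}"
    using assms by (auto simp: primitive_on_def)
  from has_integral_shift_real_ivl[OF this, of "-r"]
  show "((\<lambda>t. f (t - r)) has_integral F (t - r) - F (a + r - r)) {a + r..t}" by simp
qed

lemma primitive_on_deriv:
  assumes "\<And>t. a \<le> t \<Longrightarrow> t \<le> b \<Longrightarrow> (F has_real_derivative f t) (at t within {a..b})" "continuous_on {a..b} f"
  shows "primitive_on a b F f"
  unfolding primitive_on_def
proof (intro conjI ballI)
  show "f absolutely_integrable_on {a..b}"
    using assms(2) by (rule absolutely_integrable_continuous_real)
  fix t assume t: "t \<in> {a..b}"
  show "(f has_integral F t - F a) {a..t}"
  proof (rule fundamental_theorem_of_calculus)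
    fix s assume s: "s \<in> {a..t}"
    have "(F has_real_derivative f s) (at s within {a..t})"
      by (rule DERIV_subset[OF assms(1)]) (use s t in auto)
    then show "(F has_vector_derivative f s) (at s within {a..t})"
      by (simp add: has_real_derivative_iff_has_vector_derivative)
  qed (use t in auto)
qed

lemma absolutely_integrable_continuous_mult:
  fixes f :: "real \<Rightarrow> real"
  assumes "continuous_on {a..b} f" "g absolutely_integrable_on {a..b}"
  shows "(\<lambda>t. f t * g t) absolutely_integrable_on {a..b}"
proof (rule absolutely_integrable_bounded_measurable_product_real[OF _ _ _ assms(2)])
  show "f \<in> borel_measurable (lebesgue_on {a..b})"
    using assms(1) by (rule continuous_imp_measurable_on_sets_lebesgue) simp
  show "bounded (f ` {a..b})"
    using assms(1) by (intro compact_imp_bounded compact_continuous_image) simp_all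
qed simp

text \<open>The defect \<open>E s t\<close> of the product rule is additive in the interval and at most the square of the
  variation \<open>K t - K s\<close>; by bisection it is therefore below \<open>e * (K t - K s)\<close> for every \<open>e > 0\<close>.\<close>
theorem primitive_on_mult:
  assumes F: "primitive_on a b F f" and G: "primitive_on a b G g"
  shows "primitive_on a b (\<lambda>t. F t * G t) (\<lambda>t. f t * G t + F t * g t)"
  unfolding primitive_on_def
proof (intro conjI ballI)
  let ?h = "\<lambda>t. f t * G t + F t * g t"
  note ai = primitive_on_absolutely_integrable[OF F] primitive_on_absolutely_integrable[OF G]
  note co = primitive_on_continuous[OF F] primitive_on_continuous[OF G]
  have "(\<lambda>t. G t * f t + F t * g t) absolutely_integrable_on {a..b}"
    by (intro set_integral_add absolutely_integrable_continuous_mult ai co)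
  then show h: "?h absolutely_integrable_on {a..b}" by (simp add: mult.commute)
  fix t assume t: "t \<in> {a..b}"
  define k where "k = (\<lambda>t. \<bar>f t\<bar> + \<bar>g t\<bar>)"
  have kai: "k absolutely_integrable_on {a..b}"
    unfolding k_def by (intro set_integral_add(1) set_integrable_abs ai)
  define K where "K = (\<lambda>t. integral {a..t} k)"
  have K: "primitive_on a b K k"
    unfolding K_def by (rule primitive_on_indefinite_integral[OF kai])
  have Kmono: "K s \<le> K t" if "a \<le> s" "s \<le> t" "t \<le> b" for s t
    using has_integral_nonneg[OF primitive_on_has_integral[OF K that]] by (simp add: k_def)
  define E where "E = (\<lambda>s t. F t * G t - F s * G s - integral {s..t} ?h)"
  have sub: "f integrable_on {s..t}" "g integrable_on {s..t}" "k integrable_on {s..t}" "?h integrable_on {s..t}"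
    if "a \<le> s" "t \<le> b" for s t
    using ai kai h that
    by (auto dest!: set_lebesgue_integral_eq_integral(1) intro: integrable_on_subinterval)
  have osc: "\<bar>F t - F s\<bar> \<le> K t - K s" "\<bar>G t - G s\<bar> \<le> K t - K s" if "a \<le> s" "s \<le> t" "t \<le> b" for s t
  proof -
    note i = primitive_on_has_integral[OF F that] primitive_on_has_integral[OF G that]
      primitive_on_has_integral[OF K that]
    show "\<bar>F t - F s\<bar> \<le> K t - K s"
      using integral_norm_bound_integral[of f "{s..t}" k] i
      by (auto simp: has_integral_iff k_def)
    show "\<bar>G t - G s\<bar> \<le> K t - K s"
      using integral_norm_bound_integral[of g "{s..t}" k] i
      by (auto simp: has_integral_iff k_def)
  qed
  have quad: "\<bar>E s t\<bar> \<le> (K t - K s)\<^sup>2" if st: "a \<le> s" "s \<le> t" "t \<le> b" for s t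
  proof -
    note i = primitive_on_has_integral[OF F st] primitive_on_has_integral[OF G st]
      primitive_on_has_integral[OF K st]
    \<comment> \<open>Freezing \<open>G\<close> at the right end and \<open>F\<close> at the left
      end reproduces the increment of the product exactly: \<open>F t * G t - F s * G s\<close> is
      \<open>G t * (F t - F s) + F s * (G t - G s)\<close>. The defect is then an integral in which
      each of \<open>f\<close> and \<open>g\<close> is multiplied by an oscillation, and this makes
      it quadratic in the variation.\<close>
    have "((\<lambda>\<tau>. G t * f \<tau> + F s * g \<tau> - ?h \<tau>) has_integral
        G t * (F t - F s) + F s * (G t - G s) - integral {s..t} ?h) {s..t}"
      using sub(4)[of s t] st
      by (intro has_integral_diff has_integral_add has_integral_mult_right i integrable_integral) auto
    then have e: "((\<lambda>\<tau>. (G t - G \<tau>) * f \<tau> - (F \<tau> - F s) * g \<tau>) has_integral E s t) {s..t}"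
      by (simp add: E_def algebra_simps)
    have "norm (integral {s..t} (\<lambda>\<tau>. (G t - G \<tau>) * f \<tau> - (F \<tau> - F s) * g \<tau>))
        \<le> integral {s..t} (\<lambda>\<tau>. (K t - K s) * k \<tau>)"
    proof (rule integral_norm_bound_integral)
      fix \<tau> assume \<tau>: "\<tau> \<in> {s..t}"
      have 1: "\<bar>G t - G \<tau>\<bar> \<le> K t - K s" "\<bar>F \<tau> - F s\<bar> \<le> K t - K s"
        using osc[of \<tau> t] osc[of s \<tau>] Kmono[of s \<tau>] Kmono[of \<tau> t] \<tau> st by auto
      have "\<bar>(G t - G \<tau>) * f \<tau> - (F \<tau> - F s) * g \<tau>\<bar> \<le> \<bar>G t - G \<tau>\<bar> * \<bar>f \<tau>\<bar> + \<bar>F \<tau> - F s\<bar> * \<bar>g \<tau>\<bar>"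
        by (metis abs_mult abs_triangle_ineq4)
      also have "\<dots> \<le> (K t - K s) * \<bar>f \<tau>\<bar> + (K t - K s) * \<bar>g \<tau>\<bar>"
        by (intro add_mono mult_right_mono 1) auto
      finally show "norm ((G t - G \<tau>) * f \<tau> - (F \<tau> - F s) * g \<tau>) \<le> (K t - K s) * k \<tau>"
        by (simp add: k_def distrib_left)
    qed (use e sub(3)[of s t] st in \<open>auto simp: has_integral_iff intro!: integrable_on_mult_right\<close>)
    with e i(3) show ?thesis by (simp add: has_integral_iff power2_eq_square)
  qed
  have add: "E r t = E r s + E s t" if "a \<le> r" "r \<le> s" "s \<le> t" "t \<le> b" for r s t
    using Henstock_Kurzweil_Integration.integral_combine[of r s t ?h] sub(4)[of r t] that by (simp add: E_def)
  have small: "\<bar>E a t\<bar> \<le> e * (K t - K a)" if "e > 0" for e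
  proof -
    have "a \<le> a \<and> t \<le> b \<longrightarrow> \<bar>E a t\<bar> \<le> e * (K t - K a)"
    proof (rule Bolzano[where P="\<lambda>s t. a \<le> s \<and> t \<le> b \<longrightarrow> \<bar>E s t\<bar> \<le> e * (K t - K s)"], goal_cases)
      case 1 then show ?case using t by auto
    next
      case (2 r s t)
      show ?case
      proof
        assume rt: "a \<le> r \<and> t \<le> b"
        then have "\<bar>E r s\<bar> \<le> e * (K s - K r)" "\<bar>E s t\<bar> \<le> e * (K t - K s)" "E r t = E r s + E s t"
          using 2 add[of r s t] by auto
        then show "\<bar>E r t\<bar> \<le> e * (K t - K r)" by (simp add: algebra_simps)
      qed
    next
      case (3 x)
      then have "continuous (at x within {a..b}) K"
        using primitive_on_continuous[OF K] t by (auto simp: continuous_on_eq_continuous_within)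
      \<comment> \<open>On either side of \<open>x\<close> the variation stays below
        \<open>e/2\<close>, so on a short interval around \<open>x\<close> one factor of the square
        in \<open>quad\<close> can be replaced by \<open>e\<close>.\<close>
      then have "\<exists>d>0. \<forall>y\<in>{a..b}. dist y x < d \<longrightarrow> dist (K y) (K x) < e/2"
        unfolding continuous_within_eps_delta using half_gt_zero[OF that] by blast
      then obtain d where d: "d > 0" "\<And>y. y \<in> {a..b} \<Longrightarrow> dist y x < d \<Longrightarrow> dist (K y) (K x) < e/2"
        by blast
      show ?case
      proof (intro exI[of _ d] conjI allI impI d(1))
        fix s u assume su: "s \<le> x \<and> x \<le> u \<and> u - s < d" and ab: "a \<le> s \<and> u \<le> b"
        have "dist (K s) (K x) < e/2" "dist (K u) (K x) < e/2"
          using su ab by (intro d(2); auto simp: dist_real_def)+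
        then have "K u - K s \<le> e" unfolding dist_real_def by linarith
        moreover have "K s \<le> K u" using Kmono su ab by auto
        ultimately have "(K u - K s)\<^sup>2 \<le> e * (K u - K s)"
          by (simp add: power2_eq_square mult_right_mono)
        then show "\<bar>E s u\<bar> \<le> e * (K u - K s)" using quad[of s u] su ab by auto
      qed
    qed
    then show ?thesis using t by auto
  qed
  have "E a t = 0"
  proof (rule ccontr)
    assume ne: "E a t \<noteq> 0"
    have K0: "0 \<le> K t - K a" using Kmono[of a t] t by auto
    \<comment> \<open>Adding 1 makes \<open>M\<close> positive and strictly larger than the
      variation even when the variation is 0; the choice \<open>\<bar>E a t\<bar> / M\<close> for
      \<open>e\<close> then contradicts \<open>small\<close>.\<close>
    define M where "M = K t - K a + 1"
    have M: "M > 0" "K t - K a < M" using K0 by (auto simp: M_def)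
    have "\<bar>E a t\<bar> \<le> \<bar>E a t\<bar> / M * (K t - K a)"
      using ne M by (intro small) (auto simp: divide_pos_pos)
    also have "\<dots> < \<bar>E a t\<bar> / M * M"
      using ne M by (intro mult_strict_left_mono) (auto simp: divide_pos_pos)
    finally show False using M by simp
  qed
  then show "(?h has_integral F t * G t - F a * G a) {a..t}"
    using sub(4)[of a t] t by (auto simp: E_def has_integral_iff)
qed

text \<open>Lebesgue differentiation: outside a null set the averages of \<open>f\<close> over short
  intervals to the right of a point converge to the value of \<open>f\<close> there, and all these
  averages are 0.\<close>

lemma primitive_on_zero_imp_negligible:
  assumes F: "primitive_on a b F f" and c: "\<And>t. t \<in> {a..b} \<Longrightarrow> F t = F a"
  shows "negligible {t \<in> {a..b}. f t \<noteq> 0}"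
proof -
  \<comment> \<open>The differentiation theorem asks for integrability on every box, hence the
    extension by zero.\<close>
  let ?f = "\<lambda>t. if t \<in> {a..b} then f t else 0"
  have "f integrable_on {a..b}"
    using F set_lebesgue_integral_eq_integral(1) by (auto simp: primitive_on_def)
  then have "?f integrable_on cbox s t" for s t
    by (simp only: integrable_altD(1))
  from integrable_ccontinuous_explicit[OF this] obtain N where N: "negligible N"
    "\<And>x e. \<lbrakk>x \<notin> N; 0 < e\<rbrakk> \<Longrightarrow> \<exists>d>0. \<forall>h. 0 < h \<and> h < d \<longrightarrow>
       norm (integral (cbox x (x + h *\<^sub>R One)) ?f /\<^sub>R h ^ DIM(real) - ?f x) < e"
    by blast
  have "f x = 0" if x: "a \<le> x" "x < b" "x \<notin> N" for x
  proof (rule ccontr)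
    assume ne: "f x \<noteq> 0"
    from N(2)[OF x(3), of "\<bar>f x\<bar>"] ne obtain d where d: "d > 0"
      "\<And>h. 0 < h \<Longrightarrow> h < d \<Longrightarrow> norm (integral {x..x + h} ?f / h - ?f x) < \<bar>f x\<bar>"
      by (auto simp: divide_inverse mult.commute)
    \<comment> \<open>The second bound keeps \<open>x + h\<close> inside \<open>{a..b}\<close>,
      where \<open>F\<close> is constant. At \<open>b\<close> itself there is no room to the right,
      so that point joins the exceptional set.\<close>
    define h where "h = min (d/2) (b - x)"
    have h: "0 < h" "h < d" "x + h \<le> b" using d x by (auto simp: h_def)
    have "integral {x..x+h} ?f = integral {x..x+h} f"
      using x h by (intro Henstock_Kurzweil_Integration.integral_cong) auto
    also have "\<dots> = F (x + h) - F x"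
      using x h by (intro integral_unique primitive_on_has_integral[OF F]) auto
    also have "\<dots> = 0" using c[of "x+h"] c[of x] x h by auto
    finally show False using d(2)[of h] h x by simp
  qed
  then have "{t \<in> {a..b}. f t \<noteq> 0} \<subseteq> N \<union> {b}" by force
  with N(1) show ?thesis by (meson negligible_Un negligible_sing negligible_subset)
qed

text \<open>The integrating factor \<open>exp (- \<alpha> * t)\<close> cancels the terms with
  \<alpha> in the product rule and leaves only the forcing to be integrated.\<close>

lemma primitive_on_linear_ode:
  assumes x: "primitive_on 0 b x (\<lambda>t. \<alpha> * x t + g t)" and t: "0 \<le> t" "t \<le> b"
  shows "x t = exp (\<alpha> * t) * (x 0 + integral {0..t} (\<lambda>\<tau>. exp (- \<alpha> * \<tau>) * g \<tau>))"
proof -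
  have e: "primitive_on 0 b (\<lambda>t. exp (- \<alpha> * t)) (\<lambda>t. - \<alpha> * exp (- \<alpha> * t))"
    by (rule primitive_on_deriv) (auto intro!: derivative_eq_intros continuous_intros)
  have "((\<lambda>t. - \<alpha> * exp (- \<alpha> * t) * x t + exp (- \<alpha> * t) * (\<alpha> * x t + g t)) has_integral
      exp (- \<alpha> * t) * x t - exp (- \<alpha> * 0) * x 0) {0..t}"
    using primitive_on_mult[OF e x] t unfolding primitive_on_def by auto
  then have "((\<lambda>\<tau>. exp (- \<alpha> * \<tau>) * g \<tau>) has_integral exp (- \<alpha> * t) * x t - x 0) {0..t}"
    by (simp add: algebra_simps)
  then have "integral {0..t} (\<lambda>\<tau>. exp (- \<alpha> * \<tau>) * g \<tau>) = exp (- \<alpha> * t) * x t - x 0"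
    by (rule integral_unique)
  then show ?thesis
    by (simp add: mult.assoc[symmetric] exp_add[symmetric])
qed

text \<open>The converse direction, existence: the product rule is applied to the exponential times
  the bracket, and the two exponentials in front of \<open>g\<close> cancel.\<close>

lemma primitive_on_variation_of_constants:
  assumes g: "g absolutely_integrable_on {0..b}"
  shows "primitive_on 0 b (\<lambda>t. exp (\<alpha> * t) * (c + integral {0..t} (\<lambda>\<tau>. exp (- \<alpha> * \<tau>) * g \<tau>)))
    (\<lambda>t. \<alpha> * (exp (\<alpha> * t) * (c + integral {0..t} (\<lambda>\<tau>. exp (- \<alpha> * \<tau>) * g \<tau>))) + g t)"
proof -
  have e: "primitive_on 0 b (\<lambda>t. exp (\<alpha> * t)) (\<lambda>t. \<alpha> * exp (\<alpha> * t))"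
    by (rule primitive_on_deriv) (auto intro!: derivative_eq_intros continuous_intros)
  have "(\<lambda>\<tau>. exp (- \<alpha> * \<tau>) * g \<tau>) absolutely_integrable_on {0..b}"
    by (intro absolutely_integrable_continuous_mult g continuous_intros)
  from primitive_on_add[OF primitive_on_const[of _ _ c] primitive_on_indefinite_integral[OF this]]
  have i: "primitive_on 0 b (\<lambda>t. c + integral {0..t} (\<lambda>\<tau>. exp (- \<alpha> * \<tau>) * g \<tau>)) (\<lambda>\<tau>. exp (- \<alpha> * \<tau>) * g \<tau>)"
    by simp
  show ?thesis
    using primitive_on_mult[OF e i]
    by (rule primitive_on_cong[where S="{}"]) (auto simp: mult.assoc[symmetric] exp_add[symmetric])
qed

section \<open>Square integrable functions\<close>

text \<open>Over a closed interval measurability is meant for the restricted Lebesgue measure, which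
  gives access to the closure properties of \<open>borel_measurable\<close>.\<close>

lemma L2_on_iff:
  "L2_on {a..b} f \<longleftrightarrow> f \<in> borel_measurable (lebesgue_on {a..b}) \<and> (\<lambda>t. (f t)\<^sup>2) integrable_on {a..b}"
  by (simp add: L2_on_def measurable_on_iff_borel_measurable)

lemma L2_on_mult:
  assumes "L2_on {a..b} f" "L2_on {a..b} g"
  shows "(\<lambda>t. f t * g t) absolutely_integrable_on {a..b}"
proof (rule measurable_bounded_by_integrable_imp_absolutely_integrable)
  show "(\<lambda>t. f t * g t) \<in> borel_measurable (lebesgue_on {a..b})"
    using assms by (auto simp: L2_on_iff)
  show "(\<lambda>t. (f t)\<^sup>2 + (g t)\<^sup>2) integrable_on {a..b}"
    using assms by (auto simp: L2_on_iff intro: integrable_add)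
  show "norm (f t * g t) \<le> (f t)\<^sup>2 + (g t)\<^sup>2" for t
  proof -
    have "2 * (\<bar>f t\<bar> * \<bar>g t\<bar>) \<le> (f t)\<^sup>2 + (g t)\<^sup>2"
      using sum_squares_bound[of "\<bar>f t\<bar>" "\<bar>g t\<bar>"] by simp
    moreover have "0 \<le> \<bar>f t\<bar> * \<bar>g t\<bar>" by simp
    ultimately show ?thesis by (simp only: real_norm_def abs_mult)
  qed
qed simp

lemma L2_on_add:
  assumes "L2_on {a..b} f" "L2_on {a..b} g"
  shows "L2_on {a..b} (\<lambda>t. f t + g t)"
proof -
  have "(\<lambda>t. (f t)\<^sup>2 + (g t)\<^sup>2 + 2 * (f t * g t)) integrable_on {a..b}"
    using assms set_lebesgue_integral_eq_integral(1)[OF L2_on_mult[OF assms]]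
    by (auto simp: L2_on_iff intro!: integrable_add integrable_on_mult_right)
  with assms show ?thesis by (auto simp: L2_on_iff power2_sum algebra_simps)
qed

lemma L2_on_continuous:
  assumes "continuous_on {a..b} f"
  shows "L2_on {a..b} f"
  unfolding L2_on_iff
proof
  show "f \<in> borel_measurable (lebesgue_on {a..b})"
    using assms by (rule continuous_imp_measurable_on_sets_lebesgue) simp
  show "(\<lambda>t. (f t)\<^sup>2) integrable_on {a..b}"
    by (intro integrable_continuous_real continuous_intros assms)
qed

lemma L2_on_continuous_mult:
  assumes f: "continuous_on {a..b} f" and g: "L2_on {a..b} g"
  shows "L2_on {a..b} (\<lambda>t. f t * g t)"
proof -
  have "(\<lambda>t. (f t)\<^sup>2 * (g t)\<^sup>2) absolutely_integrable_on {a..b}"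
    using L2_on_mult[OF g g]
    by (intro absolutely_integrable_continuous_mult continuous_intros f) (simp add: power2_eq_square)
  from set_lebesgue_integral_eq_integral(1)[OF this] show ?thesis
    using g f borel_measurable_times[OF continuous_imp_measurable_on_sets_lebesgue[OF f]]
    by (auto simp: L2_on_iff power_mult_distrib)
qed

lemma L2_on_cmult: "L2_on {a..b} f \<Longrightarrow> L2_on {a..b} (\<lambda>t. c * f t)"
  by (rule L2_on_continuous_mult) auto

lemma L2_on_diff:
  assumes "L2_on {a..b} f" "L2_on {a..b} g"
  shows "L2_on {a..b} (\<lambda>t. f t - g t)"
  using L2_on_add[OF assms(1) L2_on_cmult[OF assms(2), of "-1"]] by simp

lemma L2_on_sum:
  assumes "finite I" "\<And>i. i \<in> I \<Longrightarrow> L2_on {a..b} (f i)"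
  shows "L2_on {a..b} (\<lambda>t. \<Sum>i\<in>I. f i t)"
  using assms by (induction rule: finite_induct) (auto intro: L2_on_add L2_on_continuous)

lemma L2_on_absolutely_integrable: "L2_on {a..b} f \<Longrightarrow> f absolutely_integrable_on {a..b}"
  using L2_on_mult[of a b f "\<lambda>_. 1"] by (simp add: L2_on_continuous)

lemma L2_onI:
  assumes "f absolutely_integrable_on {a..b}" "(\<lambda>t. (f t)\<^sup>2) integrable_on {a..b}"
  shows "L2_on {a..b} f"
  using assms by (auto simp: L2_on_iff intro: absolutely_integrable_imp_borel_measurable)

lemma L2_on_subinterval:
  assumes "L2_on {a..b} f" "a \<le> c" "d \<le> b"
  shows "L2_on {c..d} f"
proof (rule L2_onI)
  have sub: "{c..d} \<subseteq> {a..b}" using assms by auto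
  show "f absolutely_integrable_on {c..d}"
    by (rule absolutely_integrable_on_subinterval[OF L2_on_absolutely_integrable[OF assms(1)] sub])
  show "(\<lambda>t. (f t)\<^sup>2) integrable_on {c..d}"
    using assms(1) sub unfolding L2_on_iff by (blast intro: integrable_on_subinterval)
qed

lemma L2_on_combine:
  assumes "L2_on {a..b} f" "L2_on {b..c} f" "a \<le> b" "b \<le> c"
  shows "L2_on {a..c} f"
proof (rule L2_onI)
  show "f absolutely_integrable_on {a..c}"
    by (rule absolutely_integrable_on_combine[OF L2_on_absolutely_integrable[OF assms(1)]
        L2_on_absolutely_integrable[OF assms(2)] assms(3,4)])
  show "(\<lambda>t. (f t)\<^sup>2) integrable_on {a..c}"
    using Henstock_Kurzweil_Integration.integrable_combine[OF assms(3,4)] assms(1,2)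
    unfolding L2_on_iff by blast
qed

lemma L2_on_shift:
  assumes "L2_on {a..b} f"
  shows "L2_on {a + r..b + r} (\<lambda>t. f (t - r))"
proof (rule L2_onI)
  show "(\<lambda>t. f (t - r)) absolutely_integrable_on {a + r..b + r}"
    by (rule absolutely_integrable_shift[OF L2_on_absolutely_integrable[OF assms]])
  show "(\<lambda>t. (f (t - r))\<^sup>2) integrable_on {a + r..b + r}"
    using integrable_shift_real_ivl[of "\<lambda>t. (f t)\<^sup>2" a b "-r"] assms by (simp add: L2_on_iff)
qed

lemma L2_on_cong:
  assumes "L2_on {a..b} f" "negligible S" "\<And>t. t \<in> {a..b} - S \<Longrightarrow> g t = f t"
  shows "L2_on {a..b} g"
proof (rule L2_onI)
  show "g absolutely_integrable_on {a..b}"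
    by (rule absolutely_integrable_spike[OF L2_on_absolutely_integrable[OF assms(1)] assms(2,3)])
  show "(\<lambda>t. (g t)\<^sup>2) integrable_on {a..b}"
    by (rule integrable_spike[OF _ assms(2), of "\<lambda>t. (f t)\<^sup>2"]) (use assms(1,3) in \<open>auto simp: L2_on_iff\<close>)
qed

text \<open>Pythagoras for \<open>u = v + (u - v)\<close>: the mixed term vanishes, so the squared
  norms differ by exactly the integral of \<open>(u - v)\<^sup>2\<close>.\<close>

lemma L2_norm_le_of_orthogonal:
  assumes u: "L2_on {a..b} u" and v: "L2_on {a..b} v"
    and orth: "integral {a..b} (\<lambda>t. v t * (u t - v t)) = 0"
  shows "L2_norm_on {a..b} v \<le> L2_norm_on {a..b} u"
    and "L2_norm_on {a..b} u = L2_norm_on {a..b} v \<Longrightarrow> negligible {t \<in> {a..b}. u t \<noteq> v t}"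
proof -
  let ?w = "\<lambda>t. u t - v t"
  note w = L2_on_diff[OF u v]
  have ai: "(\<lambda>t. (?w t)\<^sup>2) absolutely_integrable_on {a..b}"
    using L2_on_mult[OF w w] by (simp add: power2_eq_square)
  have i: "(\<lambda>t. v t * ?w t) integrable_on {a..b}" "(\<lambda>t. (v t)\<^sup>2) integrable_on {a..b}"
    "(\<lambda>t. (?w t)\<^sup>2) integrable_on {a..b}"
    using set_lebesgue_integral_eq_integral(1)[OF L2_on_mult[OF v w]] v w by (auto simp: L2_on_iff)
  have "integral {a..b} (\<lambda>t. (u t)\<^sup>2) = integral {a..b} (\<lambda>t. (v t)\<^sup>2 + (?w t)\<^sup>2 + 2 * (v t * ?w t))"
    by (rule Henstock_Kurzweil_Integration.integral_cong) (simp add: power2_eq_square algebra_simps)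
  also have "\<dots> = integral {a..b} (\<lambda>t. (v t)\<^sup>2) + integral {a..b} (\<lambda>t. (?w t)\<^sup>2)"
    using i orth by (simp add: integral_add integrable_add integrable_on_mult_right)
  finally have eq: "integral {a..b} (\<lambda>t. (u t)\<^sup>2) = integral {a..b} (\<lambda>t. (v t)\<^sup>2) + integral {a..b} (\<lambda>t. (?w t)\<^sup>2)" .
  have "0 \<le> integral {a..b} (\<lambda>t. (?w t)\<^sup>2)"
    by (rule Henstock_Kurzweil_Integration.integral_nonneg[OF i(3)]) auto
  with eq show "L2_norm_on {a..b} v \<le> L2_norm_on {a..b} u"
    by (simp add: L2_norm_on_def)
  assume "L2_norm_on {a..b} u = L2_norm_on {a..b} v"
  with eq have 0: "integral {a..b} (\<lambda>t. (?w t)\<^sup>2) = 0" by (simp add: L2_norm_on_def)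
  \<comment> \<open>The integrand is nonnegative with total integral 0, so its indefinite integral
    is identically 0 and differentiation shows that it vanishes almost everywhere.\<close>
  have "integral {a..t} (\<lambda>t. (?w t)\<^sup>2) = 0" if "t \<in> {a..b}" for t
  proof -
    have "(\<lambda>t. (?w t)\<^sup>2) integrable_on {a..t}" using i(3) that by (auto intro: integrable_on_subinterval)
    then have "0 \<le> integral {a..t} (\<lambda>t. (?w t)\<^sup>2)" "integral {a..t} (\<lambda>t. (?w t)\<^sup>2) \<le> integral {a..b} (\<lambda>t. (?w t)\<^sup>2)"
      using i(3) that by (auto intro!: Henstock_Kurzweil_Integration.integral_nonneg integral_subset_le)
    with 0 show ?thesis by simp
  qed
  then show "negligible {t \<in> {a..b}. u t \<noteq> v t}"
    using primitive_on_zero_imp_negligible[OF primitive_on_indefinite_integral[OF ai]] by simp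
qed

section \<open>The optimal control\<close>

locale neutral_control =
  fixes N :: nat and r d a :: "nat \<Rightarrow> real" and y \<epsilon> T :: real
    and x0 x0' :: "real \<Rightarrow> real"
  assumes r0: "r 0 = 0" and rN: "r N = 1"
    and apos: "(\<Sum>k=0..N. (a k)\<^sup>2) > 0"
    and eps_pos: "0 < \<epsilon>"
    and eps_lt: "\<forall>s\<in>{1..N}. \<epsilon> < r s - r (s-1)"
    and T: "T = 1 + \<epsilon>"
    and state: "W12_state y x0 x0'"
begin

abbreviation "\<phi> \<equiv> phi N r d a y x0 x0'"
abbreviation "xt \<equiv> xtil N r d a y x0 x0'"
abbreviation "u0 \<equiv> uhat0 N r d a y x0 x0' \<epsilon>"
abbreviation "uh \<equiv> uhat N r d a y x0 x0' \<epsilon>"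
abbreviation "\<omega> \<equiv> ahat N d a"
abbreviation "d2 \<equiv> dsq N d"
abbreviation "c \<equiv> cconst N r d a y x0 x0' \<epsilon>"

text \<open>The coefficient 1 of the undelayed derivative is treated as the coefficient of the delay \<open>r 0 = 0\<close>.\<close>
definition dz :: "nat \<Rightarrow> real" where "dz k = (if k = 0 then 1 else d k)"

text \<open>For \<open>t\<close> in \<open>{0..\<epsilon>}\<close> every delayed argument lies in
  the initial interval, so the neutral equation becomes \<open>x' = a 0 * x + g + u\<close> with
  known forcing \<open>g\<close>.\<close>

definition g :: "real \<Rightarrow> real" where
  "g t = (\<Sum>k=1..N. a k * x0 (t - r k) - d k * x0' (t - r k))"

text \<open>The Euler-Lagrange equation involves the functions \<open>\<phi> s\<close> only through
  these two weighted sums.\<close>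

definition D\<phi> :: "real \<Rightarrow> real" where "D\<phi> t = (\<Sum>s=1..N. d s * \<phi> s t)"

definition A\<phi> :: "real \<Rightarrow> real" where "A\<phi> t = (\<Sum>s=1..N. a s * \<phi> s t)"

text \<open>With \<open>v\<close> the deviation of the state from \<open>xtil\<close>, the Euler-Lagrange equation is the system
  \<open>v' = q - D\<phi> / d2\<close>, \<open>q' = \<omega>\<^sup>2 * v - A\<phi> / d2\<close>; \<open>p \<omega>\<close> and \<open>p (- \<omega>)\<close> are its diagonal
  coordinates \<open>q + \<omega> * v\<close> and \<open>q - \<omega> * v\<close>.\<close>
definition p :: "real \<Rightarrow> real \<Rightarrow> real" where
  "p \<alpha> t = exp (\<alpha> * t) * (c / d2 +
     integral {0..t} (\<lambda>\<tau>. exp (- \<alpha> * \<tau>) * ((- A\<phi> \<tau> - \<alpha> * D\<phi> \<tau>) / d2)))"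

definition q :: "real \<Rightarrow> real" where "q t = (p \<omega> t + p (- \<omega>) t) / 2"

definition v :: "real \<Rightarrow> real" where "v t = (p \<omega> t - p (- \<omega>) t) / (2 * \<omega>)"

definition w :: "real \<Rightarrow> real" where "w t = q t - D\<phi> t / d2"

section \<open>Spacing of the delays and algebra of the coefficients\<close>

text \<open>This keeps the windows \<open>{r s..r s + \<epsilon>}\<close> disjoint and is behind
  every later case distinction on the position of a time among the delays.\<close>

lemma delay_gap:
  assumes "i < j" "j \<le> N"
  shows "r i + \<epsilon> < r j"
  using assms
proof (induction j)
  case (Suc j)
  have "r j + \<epsilon> < r (Suc j)" using eps_lt Suc.prems by force
  then show ?case using Suc eps_pos by (cases "i = j") auto
qed simp

lemma delay_bounds: "k \<le> N \<Longrightarrow> 0 \<le> r k" "k \<le> N \<Longrightarrow> r k \<le> 1"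
  using delay_gap[of 0 k] delay_gap[of k N] eps_pos r0 rN by (cases "k = 0"; cases "k = N"; force)+

lemma d2_pos: "d2 > 0"
  by (auto simp: dsq_def intro!: add_pos_nonneg sum_nonneg)

lemma \<omega>_pos: "\<omega> > 0"
  using apos d2_pos by (simp add: ahat_def)

lemma \<omega>_sq: "\<omega>\<^sup>2 * d2 = (\<Sum>k=0..N. (a k)\<^sup>2)"
  using apos d2_pos by (simp add: ahat_def)

lemma sum_dz: "(\<Sum>k=0..N. dz k * f k) = f 0 + (\<Sum>k=1..N. d k * f k)"
proof -
  have "(\<Sum>k=0..N. dz k * f k) = dz 0 * f 0 + (\<Sum>k=1..N. dz k * f k)"
    using sum.atLeast_Suc_atMost[of 0 N "\<lambda>k. dz k * f k"] by simp
  also have "(\<Sum>k=1..N. dz k * f k) = (\<Sum>k=1..N. d k * f k)"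
    by (rule sum.cong) (auto simp: dz_def)
  finally show ?thesis by (simp add: dz_def)
qed

lemma sum_dz_sq: "(\<Sum>k=0..N. dz k * dz k) = d2"
proof -
  have "(\<Sum>k=1..N. d k * dz k) = (\<Sum>k=1..N. (d k)\<^sup>2)"
    by (rule sum.cong) (auto simp: dz_def power2_eq_square)
  then show ?thesis
    using sum_dz[of dz] by (simp add: dsq_def dz_def)
qed

section \<open>Initial data and the uncontrolled state\<close>

lemma L2_x0': "L2_on {-1..0} x0'"
  using state by (auto simp: W12_state_def L2_on_def)

lemma primitive_x0: "primitive_on (-1) 0 x0 x0'"
  using state L2_on_absolutely_integrable[OF L2_x0'] by (auto simp: W12_state_def primitive_on_def)

lemma y_eq: "y = x0 0"
  using state by (simp add: W12_state_def)

lemma L2_x0'_shift: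
  assumes "-1 \<le> s" "s \<le> -\<epsilon>"
  shows "L2_on {0..\<epsilon>} (\<lambda>t. x0' (t + s))"
  using L2_on_subinterval[OF L2_on_shift[OF L2_x0', of "-s"], of 0 \<epsilon>] assms by simp

lemma continuous_x0_shift:
  assumes "-1 \<le> s" "s \<le> -\<epsilon>"
  shows "continuous_on {0..\<epsilon>} (\<lambda>t. x0 (t + s))"
  using primitive_on_continuous[OF primitive_on_subinterval[OF primitive_on_shift[OF primitive_x0, of "-s"], of 0 \<epsilon>]]
    assms by simp

lemma L2_g: "L2_on {0..\<epsilon>} g"
proof -
  have "L2_on {0..\<epsilon>} (\<lambda>t. \<Sum>k=1..N. a k * x0 (t + - r k) - d k * x0' (t + - r k))"
  proof (intro L2_on_sum L2_on_diff L2_on_cmult)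
    fix k assume "k \<in> {1..N}"
    then have k: "-1 \<le> - r k" "- r k \<le> - \<epsilon>"
      using delay_gap[of 0 k] delay_bounds[of k] r0 by auto
    show "L2_on {0..\<epsilon>} (\<lambda>t. x0 (t + - r k))" "L2_on {0..\<epsilon>} (\<lambda>t. x0' (t + - r k))"
      by (rule L2_on_continuous[OF continuous_x0_shift[OF k]] L2_x0'_shift[OF k])+
  qed simp
  then show ?thesis by (simp add: g_def[abs_def])
qed

text \<open>The last sum in \<open>phi\<close> is \<open>- g\<close>. In this form
  \<open>\<phi> s\<close> is what the control must be on the \<open>s\<close>-th window when the
  state on \<open>{0..\<epsilon>}\<close> is \<open>xt\<close>, without any deviation.\<close>

lemma phi_eq:
  "\<phi> s t = (d s * a 0 - a s) * xt t
     + (\<Sum>k=s+1..N. d k * x0' (t + (r s - r k)) - a k * x0 (t + (r s - r k))) + d s * g t"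
proof -
  have "(\<Sum>k=1..N. d k * x0' (t - r k) - a k * x0 (t - r k)) = - g t"
    unfolding g_def sum_negf[symmetric] by (rule sum.cong) auto
  then show ?thesis by (simp add: phi_def algebra_simps)
qed

text \<open>Variation of constants identifies \<open>xt\<close> as the state on
  \<open>{0..\<epsilon>}\<close> under zero control.\<close>

lemma xt_primitive: "primitive_on 0 \<epsilon> xt (\<lambda>t. a 0 * xt t + g t)"
  using primitive_on_variation_of_constants[OF L2_on_absolutely_integrable[OF L2_g], of "a 0" y]
  by (simp add: xtil_def[abs_def] g_def[abs_def])

lemma L2_phi:
  assumes "s \<in> {1..N}"
  shows "L2_on {0..\<epsilon>} (\<phi> s)"
proof -
  have "L2_on {0..\<epsilon>} (\<lambda>t. (d s * a 0 - a s) * xt t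
     + (\<Sum>k=s+1..N. d k * x0' (t + (r s - r k)) - a k * x0 (t + (r s - r k))) + d s * g t)"
  proof (intro L2_on_sum L2_on_add L2_on_diff L2_on_cmult L2_g)
    show "L2_on {0..\<epsilon>} xt"
      by (rule L2_on_continuous[OF primitive_on_continuous[OF xt_primitive]])
    fix k assume "k \<in> {s+1..N}"
    then have k: "-1 \<le> r s - r k" "r s - r k \<le> - \<epsilon>"
      using delay_gap[of s k] delay_bounds[of k] delay_bounds[of s] assms by auto
    show "L2_on {0..\<epsilon>} (\<lambda>t. x0 (t + (r s - r k)))" "L2_on {0..\<epsilon>} (\<lambda>t. x0' (t + (r s - r k)))"
      by (rule L2_on_continuous[OF continuous_x0_shift[OF k]] L2_x0'_shift[OF k])+
  qed simp
  then show ?thesis by (simp add: phi_eq[abs_def])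
qed

lemma L2_D\<phi>: "L2_on {0..\<epsilon>} D\<phi>" and L2_A\<phi>: "L2_on {0..\<epsilon>} A\<phi>"
  unfolding D\<phi>_def[abs_def] A\<phi>_def[abs_def] by (intro L2_on_sum L2_on_cmult L2_phi; simp)+

section \<open>Solution of the Euler-Lagrange system\<close>

lemma L2_forcing: "L2_on {0..\<epsilon>} (\<lambda>t. (- A\<phi> t - \<alpha> * D\<phi> t) / d2)"
proof -
  have "L2_on {0..\<epsilon>} (\<lambda>t. (- 1 / d2) * A\<phi> t - (\<alpha> / d2) * D\<phi> t)"
    by (intro L2_on_diff L2_on_cmult L2_A\<phi> L2_D\<phi>)
  then show ?thesis by (simp add: diff_divide_distrib)
qed

lemma p_primitive: "primitive_on 0 \<epsilon> (p \<alpha>) (\<lambda>t. \<alpha> * p \<alpha> t + (- A\<phi> t - \<alpha> * D\<phi> t) / d2)"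
  using primitive_on_variation_of_constants[OF L2_on_absolutely_integrable[OF L2_forcing[of \<alpha>]], of \<alpha> "c / d2"]
  by (simp add: p_def[abs_def])

text \<open>In the sum of the two diagonal equations the terms with \<open>D\<phi>\<close> cancel;
  in their difference, used for \<open>v_primitive\<close>, those with \<open>A\<phi>\<close>
  do.\<close>

lemma q_primitive: "primitive_on 0 \<epsilon> q (\<lambda>t. \<omega>\<^sup>2 * v t - A\<phi> t / d2)"
proof (rule primitive_on_cong[OF primitive_on_cmult[OF primitive_on_add[OF p_primitive[of \<omega>] p_primitive[of "- \<omega>"]],
        of "1/2"], of _ "{}"])
  show "\<omega>\<^sup>2 * v t - A\<phi> t / d2 = 1 / 2 * (\<omega> * p \<omega> t + (- A\<phi> t - \<omega> * D\<phi> t) / d2 +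
      (- \<omega> * p (- \<omega>) t + (- A\<phi> t - - \<omega> * D\<phi> t) / d2))" for t
    using \<omega>_pos d2_pos by (simp add: v_def power2_eq_square field_simps)
qed (auto simp: q_def)

lemma v_primitive: "primitive_on 0 \<epsilon> v w"
proof (rule primitive_on_cong[OF primitive_on_cmult[OF primitive_on_diff[OF p_primitive[of \<omega>] p_primitive[of "- \<omega>"]],
        of "1/(2*\<omega>)"], of _ "{}"])
  show "w t = 1 / (2*\<omega>) * (\<omega> * p \<omega> t + (- A\<phi> t - \<omega> * D\<phi> t) / d2 -
      (- \<omega> * p (- \<omega>) t + (- A\<phi> t - - \<omega> * D\<phi> t) / d2))" for t
    using \<omega>_pos d2_pos by (simp add: w_def q_def field_simps)
qed (auto simp: v_def)

text \<open>Both diagonal coordinates start at \<open>c / d2\<close>, so the deviation starts at 0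
  for any value of \<open>c\<close>; \<open>c\<close> is left to meet the condition at
  \<open>\<epsilon>\<close>.\<close>

lemma v_0: "v 0 = 0"
  by (simp add: v_def p_def)

lemma L2_w: "L2_on {0..\<epsilon>} w"
proof -
  have "L2_on {0..\<epsilon>} (\<lambda>t. q t - (1 / d2) * D\<phi> t)"
    by (intro L2_on_diff L2_on_cmult L2_D\<phi> L2_on_continuous primitive_on_continuous[OF q_primitive])
  then show ?thesis by (simp add: w_def[abs_def])
qed

text \<open>Taking the outer exponential under the integral gives the convolution form in which the
  cosh and sinh kernels of \<open>uhat0\<close> and \<open>cconst\<close> can be recognized.\<close>

lemma exp_mult_p:
  assumes "t \<in> {0..\<epsilon>}"
  shows "((\<lambda>\<tau>. exp (\<alpha> * (t - \<tau>)) * ((- A\<phi> \<tau> - \<alpha> * D\<phi> \<tau>) / d2)) has_integral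
     p \<alpha> t - exp (\<alpha> * t) * (c / d2)) {0..t}"
proof -
  have "(\<lambda>\<tau>. exp (- \<alpha> * \<tau>) * ((- A\<phi> \<tau> - \<alpha> * D\<phi> \<tau>) / d2)) absolutely_integrable_on {0..\<epsilon>}"
    by (intro absolutely_integrable_continuous_mult continuous_intros L2_on_absolutely_integrable L2_forcing)
  then have "(\<lambda>\<tau>. exp (- \<alpha> * \<tau>) * ((- A\<phi> \<tau> - \<alpha> * D\<phi> \<tau>) / d2)) integrable_on {0..t}"
    using assms by (intro integrable_on_subinterval[OF set_lebesgue_integral_eq_integral(1)]) auto
  from has_integral_mult_right[OF integrable_integral[OF this], of "exp (\<alpha> * t)"]
  show ?thesis
    by (simp add: p_def distrib_left mult.assoc[symmetric] exp_add[symmetric] right_diff_distrib)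
qed

lemma phi_kernel_integrable:
  assumes "t \<in> {0..\<epsilon>}" "s \<in> {1..N}" "continuous_on {0..t} f"
  shows "(\<lambda>\<tau>. f \<tau> * \<phi> s \<tau>) integrable_on {0..t}"
  using assms by (intro set_lebesgue_integral_eq_integral(1) absolutely_integrable_continuous_mult
      L2_on_absolutely_integrable L2_on_subinterval[OF L2_phi]) auto

text \<open>The deviation satisfies \<open>v' = a 0 * v + u0\<close> with \<open>v' = w\<close>; the
  closed formula for \<open>u0\<close> is this relation after the hyperbolic kernels are split into
  exponentials.\<close>

lemma u0_eq:
  assumes t: "t \<in> {0..\<epsilon>}"
  shows "u0 t = w t - a 0 * v t"
proof -
  let ?k = "\<lambda>s \<tau>. (d s * a 0 - a s) * cosh (\<omega> * (t - \<tau>)) + (a s * a 0 / \<omega> - d s * \<omega>) * sinh (\<omega> * (t - \<tau>))"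
  let ?e = "\<lambda>\<alpha> \<tau>. exp (\<alpha> * (t - \<tau>)) * ((- A\<phi> \<tau> - \<alpha> * D\<phi> \<tau>) / d2)"
  let ?P = "\<lambda>\<alpha>. p \<alpha> t - exp (\<alpha> * t) * (c / d2)"
  \<comment> \<open>The weights come from \<open>q t - a 0 * v t\<close>, in which
    \<open>p \<omega> t\<close> has coefficient \<open>(1 - a 0 / \<omega>) / 2\<close> and
    \<open>p (-\<omega>) t\<close> has \<open>(1 + a 0 / \<omega>) / 2\<close>.\<close>
  have "((\<lambda>\<tau>. d2 / 2 * ((1 - a 0 / \<omega>) * ?e \<omega> \<tau> + (1 + a 0 / \<omega>) * ?e (-\<omega>) \<tau>)) has_integral
      d2 / 2 * ((1 - a 0 / \<omega>) * ?P \<omega> + (1 + a 0 / \<omega>) * ?P (-\<omega>))) {0..t}"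
    by (intro has_integral_mult_right has_integral_add exp_mult_p t)
  moreover have "d2 / 2 * ((1 - a 0 / \<omega>) * ?e \<omega> \<tau> + (1 + a 0 / \<omega>) * ?e (-\<omega>) \<tau>) = (\<Sum>s=1..N. ?k s \<tau> * \<phi> s \<tau>)" for \<tau>
  proof -
    have "(\<Sum>s=1..N. ?k s \<tau> * \<phi> s \<tau>) = (a 0 * D\<phi> \<tau> - A\<phi> \<tau>) * cosh (\<omega> * (t - \<tau>))
        + (a 0 / \<omega> * A\<phi> \<tau> - \<omega> * D\<phi> \<tau>) * sinh (\<omega> * (t - \<tau>))"
      unfolding D\<phi>_def A\<phi>_def sum_distrib_left sum_distrib_right sum_subtractf[symmetric] sum.distrib[symmetric]
      by (rule sum.cong) (auto simp: algebra_simps)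
    then show ?thesis
      by (rule ssubst) (use d2_pos \<omega>_pos in \<open>simp add: cosh_field_def sinh_field_def field_simps\<close>)
  qed
  ultimately have "integral {0..t} (\<lambda>\<tau>. \<Sum>s=1..N. ?k s \<tau> * \<phi> s \<tau>)
      = d2 / 2 * ((1 - a 0 / \<omega>) * ?P \<omega> + (1 + a 0 / \<omega>) * ?P (-\<omega>))"
    by (intro integral_unique) simp
  moreover have "integral {0..t} (\<lambda>\<tau>. \<Sum>s=1..N. ?k s \<tau> * \<phi> s \<tau>) = (\<Sum>s=1..N. integral {0..t} (\<lambda>\<tau>. ?k s \<tau> * \<phi> s \<tau>))"
    by (intro Henstock_Kurzweil_Integration.integral_sum phi_kernel_integrable t continuous_intros) auto
  ultimately have "u0 t = (1 / d2) * (d2 / 2 * ((1 - a 0 / \<omega>) * ?P \<omega> + (1 + a 0 / \<omega>) * ?P (-\<omega>))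
      - D\<phi> t + c * (cosh (\<omega> * t) - a 0 / \<omega> * sinh (\<omega> * t)))"
    by (simp only: uhat0_def Let_def D\<phi>_def)
  also have "\<dots> = w t - a 0 * v t"
    using d2_pos \<omega>_pos by (simp add: w_def q_def v_def cosh_field_def sinh_field_def field_simps)
  finally show ?thesis .
qed

text \<open>This end condition is what the value of \<open>c\<close> is made for: the state
  \<open>xt + v\<close> reaches 0 at time \<open>\<epsilon>\<close>.\<close>

lemma v_eps: "v \<epsilon> = - xt \<epsilon>"
proof -
  let ?k = "\<lambda>s \<tau>. \<omega> * d s * cosh (\<omega> * (\<epsilon> - \<tau>)) + a s * sinh (\<omega> * (\<epsilon> - \<tau>))"
  let ?e = "\<lambda>\<alpha> \<tau>. exp (\<alpha> * (\<epsilon> - \<tau>)) * ((- A\<phi> \<tau> - \<alpha> * D\<phi> \<tau>) / d2)"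
  let ?P = "\<lambda>\<alpha>. p \<alpha> \<epsilon> - exp (\<alpha> * \<epsilon>) * (c / d2)"
  have "((\<lambda>\<tau>. d2 / 2 * (?e (-\<omega>) \<tau> - ?e \<omega> \<tau>)) has_integral d2 / 2 * (?P (-\<omega>) - ?P \<omega>)) {0..\<epsilon>}"
    by (intro has_integral_mult_right has_integral_diff exp_mult_p) (use eps_pos in auto)
  moreover have "d2 / 2 * (?e (-\<omega>) \<tau> - ?e \<omega> \<tau>) = (\<Sum>s=1..N. ?k s \<tau> * \<phi> s \<tau>)" for \<tau>
  proof -
    have "(\<Sum>s=1..N. ?k s \<tau> * \<phi> s \<tau>) = \<omega> * D\<phi> \<tau> * cosh (\<omega> * (\<epsilon> - \<tau>)) + A\<phi> \<tau> * sinh (\<omega> * (\<epsilon> - \<tau>))"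
      unfolding D\<phi>_def A\<phi>_def sum_distrib_left sum_distrib_right sum.distrib[symmetric]
      by (rule sum.cong) (auto simp: algebra_simps)
    then show ?thesis
      by (rule ssubst) (use d2_pos in \<open>simp add: cosh_field_def sinh_field_def field_simps\<close>)
  qed
  ultimately have "integral {0..\<epsilon>} (\<lambda>\<tau>. \<Sum>s=1..N. ?k s \<tau> * \<phi> s \<tau>) = d2 / 2 * (?P (-\<omega>) - ?P \<omega>)"
    by (intro integral_unique) simp
  then have "c = 1 / sinh (\<omega> * \<epsilon>) * (- d2 * \<omega> * xt \<epsilon> + d2 / 2 * (?P (-\<omega>) - ?P \<omega>))"
    unfolding cconst_def[of N r d a y x0 x0' \<epsilon>] Let_def by simp
  moreover have "sinh (\<omega> * \<epsilon>) \<noteq> 0" using \<omega>_pos eps_pos by simp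
  ultimately have "c * sinh (\<omega> * \<epsilon>) = - d2 * \<omega> * xt \<epsilon> + d2 / 2 * (?P (-\<omega>) - ?P \<omega>)"
    by (simp add: field_simps)
  \<comment> \<open>The subtracted exponentials in \<open>?P\<close> produce a further
    \<open>c * sinh (\<omega> * \<epsilon>)\<close>, which cancels the left side of the preceding
    equation, so \<open>c\<close> disappears.\<close>
  moreover have "d2 / 2 * (?P (-\<omega>) - ?P \<omega>) = d2 / 2 * (p (-\<omega>) \<epsilon> - p \<omega> \<epsilon>) + c * sinh (\<omega> * \<epsilon>)"
    using d2_pos by (simp add: sinh_field_def field_simps)
  ultimately have "d2 * (- (2 * \<omega> * xt \<epsilon>)) = d2 * (p \<omega> \<epsilon> - p (-\<omega>) \<epsilon>)"
    by (simp add: algebra_simps)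
  then have "- (2 * \<omega> * xt \<epsilon>) = p \<omega> \<epsilon> - p (-\<omega>) \<epsilon>"
    using d2_pos by (simp only: mult_cancel_left) auto
  then show ?thesis using \<omega>_pos by (simp add: v_def field_simps)
qed

text \<open>Variation of constants with \<open>v 0 = 0\<close>; it turns the convolution in the last
  branch of \<open>uhat\<close> into \<open>v\<close>.\<close>

lemma v_eq:
  assumes "t \<in> {0..\<epsilon>}"
  shows "integral {0..t} (\<lambda>\<tau>. exp (a 0 * (t - \<tau>)) * u0 \<tau>) = v t"
proof -
  have "primitive_on 0 \<epsilon> v (\<lambda>t. a 0 * v t + u0 t)"
    by (rule primitive_on_cong[OF v_primitive, of _ "{}"]) (auto simp: u0_eq)
  from primitive_on_linear_ode[OF this, of t] assms
  have "v t = exp (a 0 * t) * integral {0..t} (\<lambda>\<tau>. exp (- a 0 * \<tau>) * u0 \<tau>)"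
    by (simp add: v_0)
  also have "\<dots> = integral {0..t} (\<lambda>\<tau>. exp (a 0 * t) * (exp (- a 0 * \<tau>) * u0 \<tau>))"
    by simp
  finally show ?thesis
    by (simp add: mult.assoc[symmetric] exp_add[symmetric] right_diff_distrib)
qed


section \<open>The optimal state\<close>

definition X :: "real \<Rightarrow> real" where
  "X t = (if t < 0 then x0 t else if t < \<epsilon> then xt t + v t else 0)"

text \<open>The derivative of \<open>X\<close> away from the break points 0 and
  \<open>\<epsilon>\<close>: on the middle piece \<open>a 0 * xt t + g t\<close> is the derivative
  of \<open>xt\<close> and \<open>w\<close> that of \<open>v\<close>.\<close>

definition \<xi> :: "real \<Rightarrow> real" where
  "\<xi> t = (if t < 0 then x0' t else if t < \<epsilon> then a 0 * xt t + g t + w t else 0)"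

lemma xt_0: "xt 0 = y"
  by (simp add: xtil_def)

lemma X_0: "X 0 = y"
  using eps_pos by (simp add: X_def xt_0 v_0)

text \<open>The pieces fit continuously, at 0 by \<open>y_eq\<close> and \<open>v_0\<close>, at
  \<open>\<epsilon>\<close> by \<open>v_eps\<close>. The exceptional points are those where
  \<open>\<xi>\<close> already takes the value of the next piece.\<close>

lemma X_primitive: "primitive_on (-1) T X \<xi>"
proof (rule primitive_on_combine[of _ 0], goal_cases)
  case 1
  show ?case
  proof (rule primitive_on_cong[OF primitive_x0, of _ "{0}"])
    show "X t = x0 t" if "t \<in> {-1..0}" for t
      using that X_0 y_eq[symmetric] by (cases "t = 0") (auto simp: X_def)
  qed (auto simp: \<xi>_def)
next
  case 2
  show ?case
  proof (rule primitive_on_combine[of _ \<epsilon>], goal_cases)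
    case 1
    show ?case
      by (rule primitive_on_cong[OF primitive_on_add[OF xt_primitive v_primitive], of _ "{\<epsilon>}"])
         (use v_eps in \<open>auto simp: X_def \<xi>_def\<close>)
  next
    case 2
    show ?case
      by (rule primitive_on_cong[OF primitive_on_const[of _ _ 0], where S="{}"])
         (use eps_pos in \<open>auto simp: X_def \<xi>_def\<close>)
  qed (use eps_pos T in auto)
qed (use eps_pos T in auto)

lemma L2_\<xi>: "L2_on {-1..T} \<xi>"
proof (rule L2_on_combine[of _ 0], goal_cases)
  case 1
  show ?case by (rule L2_on_cong[OF L2_x0', of "{0}"]) (auto simp: \<xi>_def)
next
  case 2
  show ?case
  proof (rule L2_on_combine[of _ \<epsilon>], goal_cases)
    case 1
    have "L2_on {0..\<epsilon>} (\<lambda>t. a 0 * xt t + g t + w t)"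
      by (intro L2_on_add L2_on_cmult L2_g L2_w L2_on_continuous primitive_on_continuous[OF xt_primitive])
    then show ?case by (rule L2_on_cong[of _ _ _ "{\<epsilon>}"]) (auto simp: \<xi>_def)
  next
    case 2
    have "L2_on {\<epsilon>..T} (\<lambda>_. 0)" by (rule L2_on_continuous) simp
    then show ?case by (rule L2_on_cong[of _ _ _ "{}"]) (use eps_pos in \<open>auto simp: \<xi>_def\<close>)
  qed (use eps_pos T in auto)
qed (use eps_pos T in auto)

lemma L2_delay:
  assumes "L2_on {-1..T} f" "k \<le> N"
  shows "L2_on {0..T} (\<lambda>t. f (t - r k))"
  using L2_on_subinterval[OF L2_on_shift[OF assms(1), of "r k"], of 0 T] delay_bounds[OF assms(2)] by simp

lemma primitive_on_delay:
  assumes "primitive_on (-1) T F f" "k \<le> N"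
  shows "primitive_on 0 T (\<lambda>t. F (t - r k)) (\<lambda>t. f (t - r k))"
  using primitive_on_subinterval[OF primitive_on_shift[OF assms(1), of "r k"], of 0 T] delay_bounds[OF assms(2)]
  by simp

lemma primitive_on_neutral:
  assumes "primitive_on (-1) T F f"
  shows "primitive_on 0 T (\<lambda>t. F t + (\<Sum>k=1..N. d k * F (t - r k))) (\<lambda>t. \<Sum>k=0..N. dz k * f (t - r k))"
proof -
  have "primitive_on 0 T (\<lambda>t. \<Sum>k=0..N. dz k * F (t - r k)) (\<lambda>t. \<Sum>k=0..N. dz k * f (t - r k))"
    by (intro primitive_on_sum primitive_on_cmult primitive_on_delay[OF assms]) auto
  then show ?thesis by (simp add: sum_dz r0)
qed

section \<open>The optimal control on the delay windows and between them\<close>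

lemma interval_cases:
  assumes "0 \<le> t" "t < T"
  obtains "t < \<epsilon>"
  | s where "s \<in> {1..N}" "r (s - 1) + \<epsilon> \<le> t" "t < r s"
  | s where "s \<in> {1..N}" "r s \<le> t" "t < r s + \<epsilon>"
proof -
  \<comment> \<open>The last delay already passed locates \<open>t\<close>: either \<open>t\<close>
    is within \<open>\<epsilon>\<close> of it, or in the gap before the next delay. After
    \<open>r N = 1\<close> there is no gap, because \<open>t < T\<close>.\<close>
  define s where "s = Max {k. k \<le> N \<and> r k \<le> t}"
  have fin: "finite {k. k \<le> N \<and> r k \<le> t}" by simp
  have "s \<in> {k. k \<le> N \<and> r k \<le> t}"
    unfolding s_def using assms r0 by (intro Max_in[OF fin]) auto
  then have s: "s \<le> N" "r s \<le> t" by auto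
  have next_delay: "t < r (Suc s)" if "s < N"
    using Max_ge[OF fin, of "Suc s"] that unfolding s_def[symmetric] by force
  show ?thesis
  proof (cases "t < r s + \<epsilon>")
    case True
    then show ?thesis using that(1) that(3)[of s] s r0 by (cases "s = 0") auto
  next
    case False
    then have "s < N" using s assms rN T by (cases "s = N") auto
    then show ?thesis using that(2)[of "Suc s"] False next_delay by auto
  qed
qed

lemma uh_initial: "0 \<le> t \<Longrightarrow> t < \<epsilon> \<Longrightarrow> uh t = u0 t"
  by (simp add: uhat_def)

text \<open>Most of the work is to evaluate the nested cases of \<open>uhat\<close>: the gaps are
  disjoint, so the description under \<open>THE\<close> has only one solution, and \<open>t\<close>
  lies beyond the first branch.\<close>

lemma uh_free:
  assumes s: "s \<in> {1..N}" "r (s - 1) + \<epsilon> \<le> t" "t < r s"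
  shows "uh t = (\<Sum>k=s..N. d k * x0' (t - r k) - a k * x0 (t - r k))"
proof -
  have the: "(THE s. s \<in> {1..N} \<and> r (s-1) + \<epsilon> \<le> t \<and> t < r s) = s"
  proof (rule the_equality)
    fix s' assume s': "s' \<in> {1..N} \<and> r (s'-1) + \<epsilon> \<le> t \<and> t < r s'"
    have "r i \<le> r (j - 1)" if "i < j" "j \<le> N" for i j
      using that delay_gap[of i "j - 1"] eps_pos by (cases "i = j - 1") force+
    from this[of s s'] this[of s' s] have "\<not> s < s'" "\<not> s' < s"
      using s s' eps_pos by auto
    then show "s' = s" by simp
  qed (use s in auto)
  have "s - 1 \<le> N" using s by auto
  from delay_bounds(1)[OF this] have c1: "\<not> (0 \<le> t \<and> t < \<epsilon>)"
    using s by linarith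
  have c2: "\<exists>s\<in>{1..N}. r (s-1) + \<epsilon> \<le> t \<and> t < r s" using s by blast
  show ?thesis
    unfolding uhat_def Let_def if_not_P[OF c1] if_P[OF c2] the ..
qed

lemma uh_delayed:
  assumes s: "s \<in> {1..N}" "r s \<le> t" "t < r s + \<epsilon>"
  shows "uh t = \<phi> s (t - r s) + d s * u0 (t - r s) + (d s * a 0 - a s) * v (t - r s)"
proof -
  have the: "(THE s. s \<in> {1..N} \<and> r s \<le> t \<and> t < r s + \<epsilon>) = s"
  proof (rule the_equality)
    fix s' assume s': "s' \<in> {1..N} \<and> r s' \<le> t \<and> t < r s' + \<epsilon>"
    show "s' = s"
      using delay_gap[of s s'] delay_gap[of s' s] s s' by (cases s s' rule: linorder_cases) auto
  qed (use s in auto)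
  have c1: "\<not> (0 \<le> t \<and> t < \<epsilon>)"
    using s delay_gap[of 0 s] r0 by auto
  have c2: "\<not> (\<exists>s\<in>{1..N}. r (s-1) + \<epsilon> \<le> t \<and> t < r s)"
  proof
    assume "\<exists>s\<in>{1..N}. r (s-1) + \<epsilon> \<le> t \<and> t < r s"
    then obtain s' where s': "s' \<in> {1..N}" "r (s'-1) + \<epsilon> \<le> t" "t < r s'" by blast
    have "r s \<le> r (s' - 1)" if "s < s'"
      using that s' delay_gap[of s "s' - 1"] eps_pos by (cases "s = s' - 1") force+
    moreover have "r s' \<le> r s" if "\<not> s < s'"
      using that s delay_gap[of s' s] eps_pos by (cases "s = s'") force+
    ultimately show False using s s' by fastforce
  qed
  have c3: "\<exists>s\<in>{1..N}. r s \<le> t \<and> t < r s + \<epsilon>" using s by blast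
  have "t - r s \<in> {0..\<epsilon>}" using s by auto
  then show ?thesis
    unfolding uhat_def Let_def if_not_P[OF c1] if_not_P[OF c2] if_P[OF c3] the by (simp only: v_eq)
qed

text \<open>The control on the \<open>k\<close>-th window moved back to
  \<open>{0..\<epsilon>}\<close>, with \<open>k = 0\<close> for the initial segment. Unlike
  \<open>uh\<close>, which changes branch at the end of a window, the formula continues to
  \<open>\<epsilon>\<close>.\<close>

definition uk :: "nat \<Rightarrow> real \<Rightarrow> real" where
  "uk k t = (if k = 0 then 0 else \<phi> k t) + dz k * w t - a k * v t"

lemma uh_uk:
  assumes "k \<le> N" "0 \<le> t" "t < \<epsilon>"
  shows "uh (t + r k) = uk k t"
proof (cases "k = 0")
  case True
  then show ?thesis using uh_initial[of t] u0_eq[of t] assms r0 by (simp add: uk_def dz_def)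
next
  case False
  then show ?thesis using uh_delayed[of k "t + r k"] u0_eq[of t] assms
    by (simp add: uk_def dz_def algebra_simps)
qed

text \<open>The control is the residual of the neutral equation along \<open>X\<close>; this is why
  \<open>X\<close> is its trajectory.\<close>

lemma uh_eq:
  assumes t: "0 \<le> t" "t < T"
  shows "uh t = (\<Sum>k=0..N. dz k * \<xi> (t - r k) - a k * X (t - r k))"
proof -
  let ?F = "\<lambda>k. dz k * \<xi> (t - r k) - a k * X (t - r k)"
  let ?G = "\<lambda>k. d k * x0' (t - r k) - a k * x0 (t - r k)"
  have F0: "?F k = 0" if "r k + \<epsilon> \<le> t" for k
    using that eps_pos by (simp add: X_def \<xi>_def)
  have FG: "?F k = ?G k" if "t < r k" "k \<ge> 1" for k
    using that by (simp add: X_def \<xi>_def dz_def)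
  \<comment> \<open>At most one delay sees the controlled piece of \<open>X\<close>: for smaller
    indices the delayed argument is past \<open>\<epsilon>\<close>, where \<open>X\<close> rests,
    and for larger ones it falls into the initial data.\<close>
  have split: "(\<Sum>k=0..N. ?F k) = ?F s + (\<Sum>k=s+1..N. ?G k)"
    if s: "s \<le> N" "\<And>k. k < s \<Longrightarrow> r k + \<epsilon> \<le> t" "\<And>k. s < k \<Longrightarrow> k \<le> N \<Longrightarrow> t < r k" for s
  proof -
    have "(\<Sum>k=0..N. ?F k) = (\<Sum>k=s..N. ?F k)"
      using s by (intro sum.mono_neutral_right ballI F0) auto
    also have "\<dots> = ?F s + (\<Sum>k=s+1..N. ?F k)"
      using s(1) sum.atLeast_Suc_atMost[of s N ?F] by simp
    also have "(\<Sum>k=s+1..N. ?F k) = (\<Sum>k=s+1..N. ?G k)"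
      by (intro sum.cong FG s(3)) auto
    finally show ?thesis .
  qed
  from t show ?thesis
  proof (cases rule: interval_cases)
    case 1
    have "t < r k" if "0 < k" "k \<le> N" for k
      using delay_gap[OF that] 1 r0 by simp
    then have "(\<Sum>k=0..N. ?F k) = ?F 0 + (\<Sum>k=0+1..N. ?G k)"
      by (intro split) auto
    moreover have "(\<Sum>k=1..N. ?G k) = - g t"
      unfolding g_def sum_negf[symmetric] by (rule sum.cong) auto
    ultimately show ?thesis
      using 1 t uh_initial[of t] u0_eq[of t] r0 by (simp add: X_def \<xi>_def dz_def algebra_simps)
  next
    case (2 s)
    have gap: "r k + \<epsilon> \<le> t" if "k < s" for k
      using delay_gap[of k "s - 1"] that 2 eps_pos by (cases "k = s - 1") force+
    have "t < r k" if "s < k" "k \<le> N" for k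
      using delay_gap[of s k] that 2 eps_pos by auto
    then have "(\<Sum>k=0..N. ?F k) = ?F s + (\<Sum>k=s+1..N. ?G k)"
      using 2 gap by (intro split) auto
    \<comment> \<open>Here \<open>t\<close> has not yet reached \<open>r s\<close>, so even the
      distinguished term sees only initial data.\<close>
    also have "?F s = ?G s"
      using 2 by (intro FG) auto
    also have "?G s + (\<Sum>k=s+1..N. ?G k) = (\<Sum>k=s..N. ?G k)"
      using 2 sum.atLeast_Suc_atMost[of s N ?G] by simp
    finally show ?thesis using uh_free[OF 2] by simp
  next
    case (3 s)
    define \<sigma> where "\<sigma> = t - r s"
    have \<sigma>: "0 \<le> \<sigma>" "\<sigma> < \<epsilon>" "t = \<sigma> + r s" using 3 by (auto simp: \<sigma>_def)
    have gap: "r k + \<epsilon> \<le> t" if "k < s" for k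
      using delay_gap[of k s] that 3 by auto
    have "t < r k" if "s < k" "k \<le> N" for k
      using delay_gap[of s k] that 3 by auto
    then have "(\<Sum>k=0..N. ?F k) = ?F s + (\<Sum>k=s+1..N. ?G k)"
      using 3 gap by (intro split) auto
    also have "?F s = d s * (a 0 * xt \<sigma> + g \<sigma> + w \<sigma>) - a s * (xt \<sigma> + v \<sigma>)"
      using 3 \<sigma> by (simp add: X_def \<xi>_def dz_def)
    \<comment> \<open>This is \<open>phi_eq\<close> solved for the sum over the later delays; its
      terms with \<open>xt\<close> and \<open>g\<close> cancel those in \<open>?F s\<close>.\<close>
    also have "(\<Sum>k=s+1..N. ?G k) = \<phi> s \<sigma> - (d s * a 0 - a s) * xt \<sigma> - d s * g \<sigma>"
      by (simp add: phi_eq \<sigma>(3) add_diff_eq)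
    finally show ?thesis
      using uh_uk[of s \<sigma>] 3 \<sigma> by (simp add: uk_def dz_def algebra_simps)
  qed
qed

lemma L2_uh: "L2_on {0..T} uh"
proof -
  have "L2_on {0..T} (\<lambda>t. \<Sum>k=0..N. dz k * \<xi> (t - r k) - a k * X (t - r k))"
    by (intro L2_on_sum L2_on_diff L2_on_cmult L2_delay L2_\<xi>
        L2_on_continuous[OF primitive_on_continuous[OF X_primitive]]) auto
  then show ?thesis by (rule L2_on_cong[of _ _ _ "{T}"]) (auto simp: uh_eq)
qed

lemma X_solution: "is_solution N r d a y x0 uh T X"
  unfolding is_solution_def
proof (intro conjI ballI)
  show "continuous_on {-1..T} X" by (rule primitive_on_continuous[OF X_primitive])
  show "X 0 = y" by (rule X_0)
  show "X t = x0 t" if "t \<in> {-1..<0}" for t using that by (simp add: X_def)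
  fix t assume t: "t \<in> {0..T}"
  have "((\<lambda>t. \<Sum>k=0..N. dz k * \<xi> (t - r k)) has_integral
      X t + (\<Sum>k=1..N. d k * X (t - r k)) - (X 0 + (\<Sum>k=1..N. d k * X (0 - r k)))) {0..t}"
    using primitive_on_neutral[OF X_primitive] t unfolding primitive_on_def by blast
  then have "((\<lambda>\<tau>. (\<Sum>k=0..N. a k * X (\<tau> - r k)) + uh \<tau>) has_integral
      X t + (\<Sum>k=1..N. d k * X (t - r k)) - (X 0 + (\<Sum>k=1..N. d k * X (0 - r k)))) {0..t}"
    by (rule has_integral_spike[of "{T}", rotated 2]) (use t in \<open>auto simp: uh_eq sum_subtractf\<close>)
  from integral_unique[OF this]
  show "X t + (\<Sum>k=1..N. d k * X (t - r k)) = X 0 + (\<Sum>k=1..N. d k * X (- r k)) +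
      integral {0..t} (\<lambda>\<tau>. (\<Sum>k=0..N. a k * X (\<tau> - r k)) + uh \<tau>)"
    by simp
qed

lemma uh_admissible: "uh \<in> admissible N r d a y x0 T"
  unfolding admissible_def
  using L2_uh X_solution T eps_pos by (auto intro!: exI[of _ X] simp: X_def)

section \<open>The costate\<close>

lemma sum_dz_uk: "(\<Sum>k=0..N. dz k * uk k t) = d2 * q t - (\<Sum>k=0..N. dz k * a k) * v t"
proof -
  have "(\<Sum>k=0..N. dz k * uk k t) = (\<Sum>k=0..N. dz k * (if k = 0 then 0 else \<phi> k t))
      + (\<Sum>k=0..N. dz k * dz k) * w t - (\<Sum>k=0..N. dz k * a k) * v t"
    unfolding sum_distrib_right sum.distrib[symmetric] sum_subtractf[symmetric]
    by (rule sum.cong) (simp_all add: uk_def algebra_simps)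
  also have "(\<Sum>k=0..N. dz k * (if k = 0 then 0 else \<phi> k t)) = (\<Sum>k=1..N. d k * (if k = 0 then 0 else \<phi> k t))"
    by (simp add: sum_dz)
  also have "\<dots> = D\<phi> t"
    unfolding D\<phi>_def by (rule sum.cong) simp_all
  \<comment> \<open>Since \<open>d2 * w t\<close> is \<open>d2 * q t - D\<phi> t\<close>, the sum
    \<open>D\<phi>\<close>, known only to be square integrable, drops out. This is what makes the
    costate absolutely continuous.\<close>
  finally show ?thesis
    using d2_pos by (simp add: sum_dz_sq w_def algebra_simps)
qed

text \<open>By \<open>\<omega>_sq\<close> the coefficient of \<open>v\<close> is
  \<open>d2 * \<omega>\<^sup>2\<close>, so the bracket is the derivative of the expression found in
  \<open>sum_dz_uk\<close>.\<close>

lemma sum_a_uk: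
  "(\<Sum>k=0..N. a k * uk k t) =
     - (d2 * (\<omega>\<^sup>2 * v t - A\<phi> t / d2) - (\<Sum>k=0..N. dz k * a k) * w t)"
proof -
  have "(\<Sum>k=0..N. a k * uk k t) = (\<Sum>k=0..N. a k * (if k = 0 then 0 else \<phi> k t))
      + (\<Sum>k=0..N. dz k * a k) * w t - (\<Sum>k=0..N. (a k)\<^sup>2) * v t"
    unfolding sum_distrib_right sum.distrib[symmetric] sum_subtractf[symmetric]
    by (rule sum.cong) (simp_all add: uk_def algebra_simps power2_eq_square)
  also have "(\<Sum>k=0..N. a k * (if k = 0 then 0 else \<phi> k t)) = (\<Sum>k=1..N. a k * (if k = 0 then 0 else \<phi> k t))"
    by (simp add: sum.atLeast_Suc_atMost[of 0 N])
  also have "\<dots> = A\<phi> t"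
    unfolding A\<phi>_def by (rule sum.cong) simp_all
  finally show ?thesis
    using d2_pos by (simp add: \<omega>_sq[symmetric] algebra_simps)
qed

text \<open>The Euler-Lagrange equation in Hamiltonian form.\<close>
lemma uk_costate_primitive:
  "primitive_on 0 \<epsilon> (\<lambda>t. \<Sum>k=0..N. dz k * uk k t) (\<lambda>t. - (\<Sum>k=0..N. a k * uk k t))"
proof -
  have "primitive_on 0 \<epsilon> (\<lambda>t. d2 * q t - (\<Sum>k=0..N. dz k * a k) * v t)
      (\<lambda>t. d2 * (\<omega>\<^sup>2 * v t - A\<phi> t / d2) - (\<Sum>k=0..N. dz k * a k) * w t)"
    by (intro primitive_on_diff primitive_on_cmult q_primitive v_primitive)
  then show ?thesis unfolding sum_dz_uk sum_a_uk by simp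
qed

section \<open>Orthogonality of the optimal control to admissible variations\<close>

lemma solution_integrable:
  assumes "L2_on {0..T} u" "continuous_on {-1..T} x" "t \<in> {0..T}"
  shows "(\<lambda>\<tau>. (\<Sum>k=0..N. a k * x (\<tau> - r k)) + u \<tau>) integrable_on {0..t}"
proof -
  have "L2_on {0..T} (\<lambda>\<tau>. (\<Sum>k=0..N. a k * x (\<tau> - r k)) + u \<tau>)"
    by (intro L2_on_add assms(1) L2_on_sum L2_on_cmult L2_delay L2_on_continuous assms(2)) auto
  then have "(\<lambda>\<tau>. (\<Sum>k=0..N. a k * x (\<tau> - r k)) + u \<tau>) integrable_on {0..T}"
    by (rule set_lebesgue_integral_eq_integral(1)[OF L2_on_absolutely_integrable])
  then show ?thesis
    using assms(3) by (auto intro: integrable_on_subinterval)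
qed

lemma integral_delayed_support:
  fixes f :: "real \<Rightarrow> real"
  assumes k: "k \<le> N" and f: "f absolutely_integrable_on {0..T}"
    and supp: "\<And>t. t \<in> {0..T} \<Longrightarrow> t < r k \<or> r k + \<epsilon> < t \<Longrightarrow> f t = 0"
  shows "integral {0..T} f = integral {0..\<epsilon>} (\<lambda>t. f (t + r k))"
    and "(\<lambda>t. f (t + r k)) integrable_on {0..\<epsilon>}"
proof -
  have sub: "{r k..r k + \<epsilon>} \<subseteq> {0..T}" using delay_bounds[OF k] T by auto
  have i: "f integrable_on {0..T}" by (rule set_lebesgue_integral_eq_integral(1)[OF f])
  then have "f integrable_on {r k..r k + \<epsilon>}" using sub by (rule integrable_on_subinterval)
  then have I: "(f has_integral integral {r k..r k + \<epsilon>} f) {r k..r k + \<epsilon>}" by blast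
  have "(f has_integral integral {r k..r k + \<epsilon>} f) {0..T}"
    using I unfolding has_integral_restrict[OF sub, symmetric]
    by (rule has_integral_eq[rotated]) (use supp in force)
  moreover have "((\<lambda>t. f (t + r k)) has_integral integral {r k..r k + \<epsilon>} f) {0..\<epsilon>}"
    using has_integral_shift_real_ivl[OF I, of "r k"] by simp
  ultimately show "integral {0..T} f = integral {0..\<epsilon>} (\<lambda>t. f (t + r k))"
    "(\<lambda>t. f (t + r k)) integrable_on {0..\<epsilon>}"
    by (auto simp: has_integral_iff)
qed

text \<open>The difference \<open>z\<close> of two admissible states vanishes outside the open
  interval from 0 to \<open>\<epsilon>\<close>. Moving all windows back to
  \<open>{0..\<epsilon>}\<close> turns the inner product into the integral of the derivative of
  costate times \<open>z\<close>, whose boundary values are 0.\<close>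

lemma uh_orthogonal:
  assumes u: "u \<in> admissible N r d a y x0 T"
  shows "integral {0..T} (\<lambda>t. uh t * (u t - uh t)) = 0"
proof -
  from u obtain x where L2u: "L2_on {0..T} u" and sol: "is_solution N r d a y x0 u T x"
    and x_end: "\<And>t. t \<in> {\<epsilon>..T} \<Longrightarrow> x t = 0"
    using T by (auto simp: admissible_def)
  have cx: "continuous_on {-1..T} x" using sol by (simp add: is_solution_def)
  have cX: "continuous_on {-1..T} X" by (rule primitive_on_continuous[OF X_primitive])
  define \<delta> where "\<delta> t = u t - uh t" for t
  define z where "z t = x t - X t" for t
  \<comment> \<open>The candidate derivative of \<open>z\<close>: on the first segment all delayed
    values of \<open>z\<close> are 0, so the equation reduces to
    \<open>z' = a 0 * z + \<delta>\<close>. A solution is only required to be continuous, so that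
    \<open>z\<close> has this derivative has to be proved.\<close>
  define \<zeta> where "\<zeta> t = (if 0 \<le> t \<and> t < \<epsilon> then a 0 * z t + \<delta> t else 0)" for t
  have L2\<delta>: "L2_on {0..T} \<delta>" unfolding \<delta>_def[abs_def] by (rule L2_on_diff[OF L2u L2_uh])
  have cz: "continuous_on {-1..T} z"
    unfolding z_def[abs_def] using cx cX by (rule continuous_on_diff)
  have z_neg: "z t = 0" if "t \<in> {-1..0}" for t
    using that sol X_0 by (cases "t = 0") (auto simp: z_def is_solution_def X_def)
  have z_end: "z t = 0" if "t \<in> {\<epsilon>..T}" for t
    using x_end[OF that] that eps_pos by (simp add: z_def X_def)
  have z_eq: "z t + (\<Sum>k=1..N. d k * z (t - r k)) =
      integral {0..t} (\<lambda>\<tau>. (\<Sum>k=0..N. a k * z (\<tau> - r k)) + \<delta> \<tau>)" if t: "t \<in> {0..T}" for t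
  proof -
    have i: "(\<lambda>\<tau>. (\<Sum>k=0..N. a k * x (\<tau> - r k)) + u \<tau>) integrable_on {0..t}"
      "(\<lambda>\<tau>. (\<Sum>k=0..N. a k * X (\<tau> - r k)) + uh \<tau>) integrable_on {0..t}"
      using solution_integrable L2u L2_uh cx cX t by blast+
    have "x t + (\<Sum>k=1..N. d k * x (t - r k)) - (X t + (\<Sum>k=1..N. d k * X (t - r k))) =
        x 0 + (\<Sum>k=1..N. d k * x (- r k)) - (X 0 + (\<Sum>k=1..N. d k * X (- r k))) +
        (integral {0..t} (\<lambda>\<tau>. (\<Sum>k=0..N. a k * x (\<tau> - r k)) + u \<tau>) -
         integral {0..t} (\<lambda>\<tau>. (\<Sum>k=0..N. a k * X (\<tau> - r k)) + uh \<tau>))"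
      using sol X_solution t by (simp add: is_solution_def)
    also have "integral {0..t} (\<lambda>\<tau>. (\<Sum>k=0..N. a k * x (\<tau> - r k)) + u \<tau>) -
         integral {0..t} (\<lambda>\<tau>. (\<Sum>k=0..N. a k * X (\<tau> - r k)) + uh \<tau>) =
       integral {0..t} (\<lambda>\<tau>. (\<Sum>k=0..N. a k * z (\<tau> - r k)) + \<delta> \<tau>)"
      unfolding Henstock_Kurzweil_Integration.integral_diff[OF i, symmetric]
      by (simp add: z_def \<delta>_def right_diff_distrib sum_subtractf algebra_simps)
    finally have e: "z t + (\<Sum>k=1..N. d k * z (t - r k)) = z 0 + (\<Sum>k=1..N. d k * z (- r k)) +
        integral {0..t} (\<lambda>\<tau>. (\<Sum>k=0..N. a k * z (\<tau> - r k)) + \<delta> \<tau>)"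
      by (simp add: z_def right_diff_distrib sum_subtractf)
    have "z (- r k) = 0" if "k \<in> {1..N}" for k
      using delay_bounds[of k] that by (intro z_neg) auto
    then show ?thesis using e z_neg[of 0] by simp
  qed
  have z_primitive: "primitive_on (-1) T z \<zeta>"
  proof (rule primitive_on_combine[of _ 0], goal_cases)
    case 1
    show ?case
      by (rule primitive_on_cong[OF primitive_on_const[of _ _ 0], where S="{0}"])
         (use z_neg in \<open>auto simp: \<zeta>_def\<close>)
  next
    case 2
    show ?case
    proof (rule primitive_on_combine[of _ \<epsilon>], goal_cases)
      case 1
      have sub: "\<epsilon> \<le> T" using T by simp
      have "continuous_on {0..\<epsilon>} z"
        using continuous_on_subset[OF cz, of "{0..\<epsilon>}"] sub by auto
      then have "L2_on {0..\<epsilon>} (\<lambda>t. a 0 * z t + \<delta> t)"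
        by (intro L2_on_add L2_on_cmult L2_on_continuous L2_on_subinterval[OF L2\<delta>]) (use sub in auto)
      then have "primitive_on 0 \<epsilon> z (\<lambda>t. a 0 * z t + \<delta> t)"
      proof (rule primitive_onI[OF L2_on_absolutely_integrable])
        fix t assume t: "0 \<le> t" "t \<le> \<epsilon>"
        have delayed: "z (\<tau> - r k) = 0" if "k \<in> {1..N}" "\<tau> \<in> {0..t}" for k \<tau>
          using delay_gap[of 0 k] delay_bounds[of k] r0 that t by (intro z_neg) auto
        have "z t + (\<Sum>k=1..N. d k * z (t - r k)) =
            integral {0..t} (\<lambda>\<tau>. (\<Sum>k=0..N. a k * z (\<tau> - r k)) + \<delta> \<tau>)"
          using t sub by (intro z_eq) auto
        also have "\<dots> = integral {0..t} (\<lambda>\<tau>. a 0 * z \<tau> + \<delta> \<tau>)"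
          using delayed by (intro Henstock_Kurzweil_Integration.integral_cong)
            (simp add: sum.atLeast_Suc_atMost[of 0 N] r0)
        finally show "z t = z 0 + integral {0..t} (\<lambda>t. a 0 * z t + \<delta> t)"
          using delayed z_neg[of 0] t by simp
      qed
      then show ?case
        by (rule primitive_on_cong[where S="{\<epsilon>}"]) (auto simp: \<zeta>_def)
    next
      case 2
      show ?case
        by (rule primitive_on_cong[OF primitive_on_const[of _ _ 0], where S="{}"])
           (use z_end eps_pos in \<open>auto simp: \<zeta>_def\<close>)
    qed (use eps_pos T in auto)
  qed (use eps_pos T in auto)
  have L2\<zeta>: "L2_on {-1..T} \<zeta>"
  proof (rule L2_on_combine[of _ 0], goal_cases)
    case 1
    have "L2_on {-1..0::real} (\<lambda>_. 0)" by (rule L2_on_continuous) simp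
    then show ?case by (rule L2_on_cong[where S="{0}"]) (auto simp: \<zeta>_def)
  next
    case 2
    show ?case
    proof (rule L2_on_combine[of _ \<epsilon>], goal_cases)
      case 1
      have sub: "\<epsilon> \<le> T" using T by simp
      have "continuous_on {0..\<epsilon>} z"
        using continuous_on_subset[OF cz, of "{0..\<epsilon>}"] sub by auto
      then have "L2_on {0..\<epsilon>} (\<lambda>t. a 0 * z t + \<delta> t)"
        by (intro L2_on_add L2_on_cmult L2_on_continuous L2_on_subinterval[OF L2\<delta>]) (use sub in auto)
      then show ?case by (rule L2_on_cong[where S="{\<epsilon>}"]) (auto simp: \<zeta>_def)
    next
      case 2
      have "L2_on {\<epsilon>..T} (\<lambda>_. 0)" by (rule L2_on_continuous) simp
      then show ?case by (rule L2_on_cong[where S="{}"]) (auto simp: \<zeta>_def)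
    qed (use eps_pos T in auto)
  qed (use eps_pos T in auto)
  \<comment> \<open>The contribution of delay \<open>k\<close> to \<open>\<delta>\<close>, before
    the shift by \<open>r k\<close>; it vanishes outside \<open>{0..\<epsilon>}\<close>.\<close>
  define \<eta> where "\<eta> k t = dz k * \<zeta> t - a k * z t" for k t
  have L2\<eta>: "L2_on {-1..T} (\<eta> k)" for k
    unfolding \<eta>_def[abs_def] by (intro L2_on_diff L2_on_cmult L2\<zeta> L2_on_continuous cz)
  have \<eta>_supp: "\<eta> k t = 0" if "t \<in> {-1..T}" "t < 0 \<or> \<epsilon> < t" for k t
    using that z_neg[of t] z_end[of t] by (auto simp: \<eta>_def \<zeta>_def)
  \<comment> \<open>The integrated equation holds at every time, so its two sides have the same
    derivative almost everywhere; this recovers \<open>\<delta>\<close> as the sum of the shifted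
    \<open>\<eta> k\<close>.\<close>
  have neg: "negligible {t \<in> {0..T}. (\<Sum>k=0..N. \<eta> k (t - r k)) - \<delta> t \<noteq> 0}"
  proof -
    define f where "f \<tau> = (\<Sum>k=0..N. a k * z (\<tau> - r k)) + \<delta> \<tau>" for \<tau>
    have "L2_on {0..T} f"
      unfolding f_def[abs_def]
      by (intro L2_on_add L2\<delta> L2_on_sum L2_on_cmult L2_delay L2_on_continuous cz) auto
    from primitive_on_diff[OF primitive_on_neutral[OF z_primitive]
        primitive_on_indefinite_integral[OF L2_on_absolutely_integrable[OF this]]]
    have F: "primitive_on 0 T (\<lambda>t. z t + (\<Sum>k=1..N. d k * z (t - r k)) - integral {0..t} f)
      (\<lambda>t. (\<Sum>k=0..N. dz k * \<zeta> (t - r k)) - f t)" .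
    have F0: "z t + (\<Sum>k=1..N. d k * z (t - r k)) - integral {0..t} f = 0" if "t \<in> {0..T}" for t
      using z_eq[OF that] by (simp add: f_def[abs_def])
    have "negligible {t \<in> {0..T}. (\<Sum>k=0..N. dz k * \<zeta> (t - r k)) - f t \<noteq> 0}"
    proof (rule primitive_on_zero_imp_negligible[OF F])
      have "0 \<in> {0..T}" using eps_pos T by simp
      then show "z t + (\<Sum>k=1..N. d k * z (t - r k)) - integral {0..t} f =
          z 0 + (\<Sum>k=1..N. d k * z (0 - r k)) - integral {0..0} f" if "t \<in> {0..T}" for t
        using F0 that by metis
    qed
    then show ?thesis by (simp add: \<eta>_def f_def sum_subtractf algebra_simps)
  qed
  have ai: "(\<lambda>t. uh t * \<eta> k (t - r k)) absolutely_integrable_on {0..T}" if "k \<le> N" for k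
    using that by (intro L2_on_mult L2_uh L2_delay L2\<eta>)
  have piece: "integral {0..T} (\<lambda>t. uh t * \<eta> k (t - r k)) = integral {0..\<epsilon>} (\<lambda>t. uk k t * \<eta> k t)"
    "(\<lambda>t. uk k t * \<eta> k t) integrable_on {0..\<epsilon>}" if k: "k \<le> N" for k
  proof -
    have "uh t * \<eta> k (t - r k) = 0" if "t \<in> {0..T}" "t < r k \<or> r k + \<epsilon> < t" for t
      using \<eta>_supp[of "t - r k" k] that delay_bounds[OF k] by auto
    from integral_delayed_support[OF k ai[OF k] this]
    have 1: "integral {0..T} (\<lambda>t. uh t * \<eta> k (t - r k)) = integral {0..\<epsilon>} (\<lambda>t. uh (t + r k) * \<eta> k t)"
      "(\<lambda>t. uh (t + r k) * \<eta> k t) integrable_on {0..\<epsilon>}"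
      by simp_all
    \<comment> \<open>The point \<open>\<epsilon>\<close> is exempted because \<open>uh_uk\<close>
      reaches only up to, but not including, the end of the window.\<close>
    have "integral {0..\<epsilon>} (\<lambda>t. uh (t + r k) * \<eta> k t) = integral {0..\<epsilon>} (\<lambda>t. uk k t * \<eta> k t)"
      by (rule integral_spike[of "{\<epsilon>}"]) (use k uh_uk in auto)
    with 1(1) show "integral {0..T} (\<lambda>t. uh t * \<eta> k (t - r k)) = integral {0..\<epsilon>} (\<lambda>t. uk k t * \<eta> k t)"
      by simp
    show "(\<lambda>t. uk k t * \<eta> k t) integrable_on {0..\<epsilon>}"
      by (rule integrable_spike[OF 1(2), of "{\<epsilon>}"]) (use k uh_uk in auto)
  qed
  have "integral {0..T} (\<lambda>t. uh t * \<delta> t) = integral {0..T} (\<lambda>t. \<Sum>k=0..N. uh t * \<eta> k (t - r k))"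
    by (rule integral_spike[OF neg]) (auto simp: sum_distrib_left[symmetric])
  also have "\<dots> = (\<Sum>k=0..N. integral {0..T} (\<lambda>t. uh t * \<eta> k (t - r k)))"
    by (intro Henstock_Kurzweil_Integration.integral_sum set_lebesgue_integral_eq_integral(1)[OF ai]) auto
  also have "\<dots> = (\<Sum>k=0..N. integral {0..\<epsilon>} (\<lambda>t. uk k t * \<eta> k t))"
    by (intro sum.cong piece) auto
  also have "\<dots> = integral {0..\<epsilon>} (\<lambda>t. \<Sum>k=0..N. uk k t * \<eta> k t)"
    by (intro Henstock_Kurzweil_Integration.integral_sum[symmetric] piece) auto
  \<comment> \<open>Collecting the coefficients of \<open>z\<close> and \<open>\<zeta>\<close>
    exhibits the product rule for the costate times \<open>z\<close>, by
    \<open>uk_costate_primitive\<close>.\<close>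
  also have "\<dots> = integral {0..\<epsilon>} (\<lambda>t. - (\<Sum>k=0..N. a k * uk k t) * z t + (\<Sum>k=0..N. dz k * uk k t) * \<zeta> t)"
    by (rule Henstock_Kurzweil_Integration.integral_cong)
       (simp add: \<eta>_def right_diff_distrib sum_subtractf sum_distrib_left sum_distrib_right algebra_simps)
  also have "\<dots> = (\<Sum>k=0..N. dz k * uk k \<epsilon>) * z \<epsilon> - (\<Sum>k=0..N. dz k * uk k 0) * z 0"
  proof (rule integral_unique)
    have "primitive_on 0 \<epsilon> z \<zeta>"
      by (rule primitive_on_subinterval[OF z_primitive]) (use T in auto)
    from primitive_on_has_integral[OF primitive_on_mult[OF uk_costate_primitive this], of 0 \<epsilon>]
    show "((\<lambda>t. - (\<Sum>k=0..N. a k * uk k t) * z t + (\<Sum>k=0..N. dz k * uk k t) * \<zeta> t) has_integral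
      (\<Sum>k=0..N. dz k * uk k \<epsilon>) * z \<epsilon> - (\<Sum>k=0..N. dz k * uk k 0) * z 0) {0..\<epsilon>}"
      using eps_pos by simp
  qed
  also have "\<dots> = 0"
    using z_neg[of 0] z_end[of \<epsilon>] T by simp
  finally show ?thesis by (simp add: \<delta>_def)
qed

end

theorem mainTheorem6:
  fixes N :: nat and r d a :: "nat \<Rightarrow> real" and y \<epsilon> T :: real
    and x0 x0' :: "real \<Rightarrow> real"
  assumes N: "N \<ge> 1"
    and r0: "r 0 = 0" and rN: "r N = 1"
    and rmono: "\<forall>s\<in>{1..N}. r (s-1) < r s"
    and dNaN: "(d N)\<^sup>2 + (a N)\<^sup>2 \<noteq> 0"
    and apos: "(\<Sum>k=0..N. (a k)\<^sup>2) > 0"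
    and eps_pos: "0 < \<epsilon>"
    and eps_lt: "\<forall>s\<in>{1..N}. \<epsilon> < r s - r (s-1)"
    and T: "T = 1 + \<epsilon>"
    and state: "W12_state y x0 x0'"
  shows "uhat N r d a y x0 x0' \<epsilon> \<in> admissible N r d a y x0 T \<and>
         (\<forall>u\<in>admissible N r d a y x0 T.
            L2_norm_on {0..T} (uhat N r d a y x0 x0' \<epsilon>) \<le> L2_norm_on {0..T} u) \<and>
         (\<forall>u\<in>admissible N r d a y x0 T.
            L2_norm_on {0..T} u = L2_norm_on {0..T} (uhat N r d a y x0 x0' \<epsilon>) \<longrightarrow>
            negligible {t\<in>{0..T}. u t \<noteq> uhat N r d a y x0 x0' \<epsilon> t})"
proof -
  interpret neutral_control N r d a y \<epsilon> T x0 x0'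
    by unfold_locales (fact r0 rN apos eps_pos eps_lt T state)+
  have L2: "L2_on {0..T} u" if "u \<in> admissible N r d a y x0 T" for u
    using that by (simp add: admissible_def)
  show ?thesis
    using uh_admissible L2_norm_le_of_orthogonal[OF L2 L2_uh uh_orthogonal] by blast
qed

end
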